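(* For every frame $L$, the congruence biframe $(\mathbb{C}L, \nabla L, \Delta L)$ equipped with its well-monotone quasi-uniformity is bicomplete.
   Context: **Biframes.** A biframe is a triple of frames $\mathcal{L}=(\mathcal{L}_0,\mathcal{L}_1,\mathcal{L}_2)$ where $\mathcal{L}_1,\mathcal{L}_2$ are subframes of $\mathcal{L}_0$ which together generate $\mathcal{L}_0$; $\mathcal{L}_0$ is the total part, $\mathcal{L}_1$ the first part, $\mathcal{L}_2$ the second part. A biframe homomorphism $h:\mathcal{L}\to\mathcal{M}$ is a frame homomorphism $h_0:\mathcal{L}_0\to\mathcal{M}_0$ with $h_0(\mathcal{L}_i)\subseteq\mathcal{M}_i$ for $i=1,2$; its restrictions are $h_i:\mathcal{L}_i\to\mathcal{M}_i$. It is surjective if $h_1$ and $h_2$ are surjective, and dense if $h_0(x)=0$ implies $x=0$. Below $i,j\in\{1,2\}$ with $i\neq j$. Smallest and largest elements of frames are $0$ and $1$. **Congruence biframes.** A (frame) congruence on a frame $L$ is an equivalence relation on $L$ which is a subframe of $L\times L$. The congruences on $L$, ordered by inclusion, form a frame $\mathbb{C}L$. For $a\in L$ let $\nabla_a=\{(x,y)\mid x\vee a=y\vee a\}$ (closed congruence) and $\Delta_a=\{(x,y)\mid x\wedge a=y\wedge a\}$ (open congruence); these are complements of each other in $\mathbb{C}L$. Let $\nabla L$ be the subframe of closed congruences ($\cong L$ via $a\mapsto\nabla_a$) and $\Delta L$ the subframe generated by the open congruences. The congruence biframe of $L$ is $(\mathbb{C}L,\nabla L,\Delta L)$. It is strictly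 zero-dimensional, where a biframe $\mathcal{L}$ is strictly zero-dimensional if every $a\in\mathcal{L}_1$ has a complement $a^{\mathsf c}$ in $\mathcal{L}_0$ with $a^{\mathsf c}\in\mathcal{L}_2$, and these complements generate $\mathcal{L}_2$. **Quasi-uniform biframes.** A paircover on $\mathcal{L}$ is a downset $U\subseteq\mathcal{L}_1\times\mathcal{L}_2$ with $\bigvee_{(x,y)\in U}x\wedge y=1$. It is strong if it is generated as a downset by pairs $(x,y)$ with $x\wedge y\neq 0$. For $x\in\mathcal{L}_i$, $\mathrm{st}_i(x,U)=\bigvee\{u_i\mid (u_1,u_2)\in U,\ x\wedge u_j\neq 0\}$, and $U^*={\downarrow}\{(\mathrm{st}_1(u_1,U),\mathrm{st}_2(u_2,U))\mid (u_1,u_2)\in U\}$. A quasi-uniformity on $\mathcal{L}$ is a filter $\mathcal{U}$ (with respect to inclusion) of paircovers such that (i) every $U\in\mathcal{U}$ contains a strong $V\in\mathcal{U}$; (ii) for every $U\in\mathcal{U}$ there is $V\in\mathcal{U}$ with $V^*\subseteq U$; (iii) for all $x\in\mathcal{L}_i$, $x=\bigvee\{y\in\mathcal{L}_i\mid \exists U\in\mathcal{U}.\ \mathrm{st}_i(y,U)\le x\}$. A quasi-uniform homomorphism $f:(\mathcal{L},\mathcal{U})\to(\mathcal{M},\mathcal{V})$ is a biframe homomorphism such that ${\downarrow}(f_1\times f_2)(U)\in\mathcal{V}$ for all $U\in\mathcal{U}$. It is a quasi-uniform surjection if moreover $f$ is a surjective biframe homomorphism and the downsets ${\downarrow}(f_1\times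 f_2)(U)$, $U\in\mathcal{U}$, form a base of the filter $\mathcal{V}$. A quasi-uniform biframe $\mathcal{L}$ is bicomplete if every dense quasi-uniform surjection $\mathcal{M}\twoheadrightarrow\mathcal{L}$ from a quasi-uniform biframe $\mathcal{M}$ is an isomorphism. **Well-monotone quasi-uniformity.** Let $\mathcal{L}$ be strictly zero-dimensional. For $A\subseteq\mathcal{L}_1$ let $C_A=\bigcap_{a\in A}\big({\downarrow}(a,1)\cup{\downarrow}(1,a^{\mathsf c})\big)$ and $\widetilde{C}_A={\downarrow}\{(x,y)\in C_A\mid x\wedge y\neq 0\}$. A well-ordered cover of $\mathcal{L}_1$ is a subset $A\subseteq\mathcal{L}_1$ with $\bigvee A=1$ which is well-ordered by the order of $\mathcal{L}_1$; for such $A$, $C_A$ and $\widetilde{C}_A$ are paircovers. The well-monotone quasi-uniformity on $\mathcal{L}$ is the quasi-uniformity generated by the $\widetilde{C}_A$ for $A$ a well-ordered cover of $\mathcal{L}_1$, i.e. the smallest quasi-uniformity containing all of them; explicitly, it consists of all downsets of $\mathcal{L}_1\times\mathcal{L}_2$ containing $\widetilde{C}_{A_1\cup\dots\cup A_n}$ for some finitely many well-ordered covers $A_1,\dots,A_n$. *)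

theory Defs
  imports Main "HOL.Hull" "HOL-Library.Product_Order"
begin

section \<open>Frames\<close>

class frame = complete_lattice +
  assumes inf_Sup_le: "inf a (Sup B) \<le> Sup (inf a ` B)"
begin

lemma inf_Sup_frame: "inf a (Sup B) = Sup (inf a ` B)"
  by (rule order.antisym[OF inf_Sup_le]) (auto intro!: SUP_least intro: le_infI2 Sup_upper)

subclass distrib_lattice
proof
  fix x y z :: 'a
  have "inf a (sup b c) = sup (inf a b) (inf a c)" for a b c
    using inf_Sup_frame[of a "{b, c}"] by simp
  then show "sup x (inf y z) = inf (sup x y) (sup x z)"
    by (rule distrib_imp1)
qed

end

instance prod :: (frame, frame) frame
proof
  fix a :: "'a \<times> 'b" and B
  show "inf a (Sup B) \<le> Sup (inf a ` B)"
    by (simp add: less_eq_prod_def fst_Sup snd_Sup inf_Sup_frame image_image)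
qed

definition subframe :: "'a::frame set \<Rightarrow> bool" where
  "subframe S \<longleftrightarrow>
     top \<in> S \<and> (\<forall>x\<in>S. \<forall>y\<in>S. inf x y \<in> S) \<and> (\<forall>A. A \<subseteq> S \<longrightarrow> Sup A \<in> S)"

definition frame_hom :: "('a::frame \<Rightarrow> 'b::frame) \<Rightarrow> bool" where
  "frame_hom h \<longleftrightarrow>
     h top = top \<and> (\<forall>x y. h (inf x y) = inf (h x) (h y)) \<and> (\<forall>A. h (Sup A) = Sup (h ` A))"

definition complement_of :: "'a::frame \<Rightarrow> 'a \<Rightarrow> bool" where
  "complement_of a b \<longleftrightarrow> inf a b = bot \<and> sup a b = top"

lemma complement_of_unique: "complement_of a b \<Longrightarrow> complement_of a c \<Longrightarrow> b = c"
  unfolding complement_of_def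
  by (metis inf_commute inf_sup_distrib1 inf_top.right_neutral)

text \<open>Only meaningful for complemented elements.\<close>

definition frame_compl :: "'a::frame \<Rightarrow> 'a" where
  "frame_compl a = (THE b. complement_of a b)"

lemma frame_compl_eqI: "complement_of a b \<Longrightarrow> frame_compl a = b"
  unfolding frame_compl_def using complement_of_unique by blast


section \<open>Biframes\<close>

text \<open>The total part of a biframe is the whole of a type of class \<^class>\<open>frame\<close>; a biframe
  is thus given by its first part \<open>L1\<close> and its second part \<open>L2\<close>.\<close>

definition biframe :: "'a::frame set \<Rightarrow> 'a set \<Rightarrow> bool" where
  "biframe L1 L2 \<longleftrightarrow> subframe L1 \<and> subframe L2 \<and> subframe hull (L1 \<union> L2) = UNIV"

definition biframe_hom ::
    "'a::frame set \<Rightarrow> 'a set \<Rightarrow> 'b::frame set \<Rightarrow> 'b set \<Rightarrow> ('a \<Rightarrow> 'b) \<Rightarrow> bool" where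
  "biframe_hom L1 L2 M1 M2 h \<longleftrightarrow> frame_hom h \<and> h ` L1 \<subseteq> M1 \<and> h ` L2 \<subseteq> M2"

definition biframe_surjection ::
    "'a::frame set \<Rightarrow> 'a set \<Rightarrow> 'b::frame set \<Rightarrow> 'b set \<Rightarrow> ('a \<Rightarrow> 'b) \<Rightarrow> bool" where
  "biframe_surjection L1 L2 M1 M2 h \<longleftrightarrow>
     biframe_hom L1 L2 M1 M2 h \<and> h ` L1 = M1 \<and> h ` L2 = M2"

definition dense_hom :: "('a::frame \<Rightarrow> 'b::frame) \<Rightarrow> bool" where
  "dense_hom h \<longleftrightarrow> (\<forall>x. h x = bot \<longrightarrow> x = bot)"

definition strictly_zero_dimensional :: "'a::frame set \<Rightarrow> 'a set \<Rightarrow> bool" where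
  "strictly_zero_dimensional L1 L2 \<longleftrightarrow>
     biframe L1 L2 \<and> (\<forall>a\<in>L1. \<exists>b\<in>L2. complement_of a b) \<and> subframe hull (frame_compl ` L1) = L2"


section \<open>Quasi-uniform biframes\<close>

text \<open>Down-closure in \<open>L1 \<times> L2\<close>, not in the product of the total parts.\<close>

definition down :: "'a::frame set \<Rightarrow> 'a set \<Rightarrow> ('a \<times> 'a) set \<Rightarrow> ('a \<times> 'a) set" where
  "down L1 L2 U = {q \<in> L1 \<times> L2. \<exists>p\<in>U. q \<le> p}"

definition downset :: "'a::frame set \<Rightarrow> 'a set \<Rightarrow> ('a \<times> 'a) set \<Rightarrow> bool" where
  "downset L1 L2 U \<longleftrightarrow> U \<subseteq> L1 \<times> L2 \<and> (\<forall>p\<in>U. \<forall>q\<in>L1 \<times> L2. q \<le> p \<longrightarrow> q \<in> U)"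

definition paircover :: "'a::frame set \<Rightarrow> 'a set \<Rightarrow> ('a \<times> 'a) set \<Rightarrow> bool" where
  "paircover L1 L2 U \<longleftrightarrow> downset L1 L2 U \<and> (SUP (x, y)\<in>U. inf x y) = top"

definition strong :: "'a::frame set \<Rightarrow> 'a set \<Rightarrow> ('a \<times> 'a) set \<Rightarrow> bool" where
  "strong L1 L2 U \<longleftrightarrow>
     (\<exists>G \<subseteq> {(x, y) \<in> L1 \<times> L2. inf x y \<noteq> bot}. U = down L1 L2 G)"

definition st1 :: "'a::frame \<Rightarrow> ('a \<times> 'a) set \<Rightarrow> 'a" where
  "st1 x U = Sup {u1 | u1 u2. (u1, u2) \<in> U \<and> inf x u2 \<noteq> bot}"

definition st2 :: "'a::frame \<Rightarrow> ('a \<times> 'a) set \<Rightarrow> 'a" where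
  "st2 x U = Sup {u2 | u1 u2. (u1, u2) \<in> U \<and> inf x u1 \<noteq> bot}"

definition star :: "'a::frame set \<Rightarrow> 'a set \<Rightarrow> ('a \<times> 'a) set \<Rightarrow> ('a \<times> 'a) set" where
  "star L1 L2 U = down L1 L2 {(st1 u1 U, st2 u2 U) | u1 u2. (u1, u2) \<in> U}"

definition paircover_filter :: "'a::frame set \<Rightarrow> 'a set \<Rightarrow> ('a \<times> 'a) set set \<Rightarrow> bool" where
  "paircover_filter L1 L2 \<U> \<longleftrightarrow>
     (\<forall>U\<in>\<U>. paircover L1 L2 U) \<and> \<U> \<noteq> {} \<and>
     (\<forall>U\<in>\<U>. \<forall>V. paircover L1 L2 V \<and> U \<subseteq> V \<longrightarrow> V \<in> \<U>) \<and>
     (\<forall>U\<in>\<U>. \<forall>V\<in>\<U>. U \<inter> V \<in> \<U>)"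

definition quasi_uniformity :: "'a::frame set \<Rightarrow> 'a set \<Rightarrow> ('a \<times> 'a) set set \<Rightarrow> bool" where
  "quasi_uniformity L1 L2 \<U> \<longleftrightarrow>
     paircover_filter L1 L2 \<U> \<and>
     (\<forall>U\<in>\<U>. \<exists>V\<in>\<U>. strong L1 L2 V \<and> V \<subseteq> U) \<and>
     (\<forall>U\<in>\<U>. \<exists>V\<in>\<U>. star L1 L2 V \<subseteq> U) \<and>
     (\<forall>x\<in>L1. x = Sup {y \<in> L1. \<exists>U\<in>\<U>. st1 y U \<le> x}) \<and>
     (\<forall>x\<in>L2. x = Sup {y \<in> L2. \<exists>U\<in>\<U>. st2 y U \<le> x})"

definition quasi_uniform_biframe :: "'a::frame set \<Rightarrow> 'a set \<Rightarrow> ('a \<times> 'a) set set \<Rightarrow> bool" where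
  "quasi_uniform_biframe L1 L2 \<U> \<longleftrightarrow> biframe L1 L2 \<and> quasi_uniformity L1 L2 \<U>"

definition quasi_uniform_hom ::
    "'a::frame set \<Rightarrow> 'a set \<Rightarrow> ('a \<times> 'a) set set \<Rightarrow>
     'b::frame set \<Rightarrow> 'b set \<Rightarrow> ('b \<times> 'b) set set \<Rightarrow> ('a \<Rightarrow> 'b) \<Rightarrow> bool" where
  "quasi_uniform_hom L1 L2 \<U> M1 M2 \<V> f \<longleftrightarrow>
     biframe_hom L1 L2 M1 M2 f \<and> (\<forall>U\<in>\<U>. down M1 M2 (map_prod f f ` U) \<in> \<V>)"

definition quasi_uniform_surjection ::
    "'a::frame set \<Rightarrow> 'a set \<Rightarrow> ('a \<times> 'a) set set \<Rightarrow>
     'b::frame set \<Rightarrow> 'b set \<Rightarrow> ('b \<times> 'b) set set \<Rightarrow> ('a \<Rightarrow> 'b) \<Rightarrow> bool" where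
  "quasi_uniform_surjection L1 L2 \<U> M1 M2 \<V> f \<longleftrightarrow>
     quasi_uniform_hom L1 L2 \<U> M1 M2 \<V> f \<and> biframe_surjection L1 L2 M1 M2 f \<and>
     (\<forall>V\<in>\<V>. \<exists>U\<in>\<U>. down M1 M2 (map_prod f f ` U) \<subseteq> V)"

definition quasi_uniform_iso ::
    "'a::frame set \<Rightarrow> 'a set \<Rightarrow> ('a \<times> 'a) set set \<Rightarrow>
     'b::frame set \<Rightarrow> 'b set \<Rightarrow> ('b \<times> 'b) set set \<Rightarrow> ('a \<Rightarrow> 'b) \<Rightarrow> bool" where
  "quasi_uniform_iso L1 L2 \<U> M1 M2 \<V> f \<longleftrightarrow>
     quasi_uniform_hom L1 L2 \<U> M1 M2 \<V> f \<and>
     (\<exists>g. quasi_uniform_hom M1 M2 \<V> L1 L2 \<U> g \<and> g \<circ> f = id \<and> f \<circ> g = id)"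

text \<open>HOL cannot quantify over types inside a definition, so the type of the total part of the
  covering biframe \<open>M\<close> is a parameter. A theorem with conclusion
  \<open>bicomplete TYPE('m) L1 L2 \<U>\<close> for a type variable \<open>'m\<close> ranges over all of them.\<close>

definition bicomplete ::
    "'m::frame itself \<Rightarrow> 'a::frame set \<Rightarrow> 'a set \<Rightarrow> ('a \<times> 'a) set set \<Rightarrow> bool" where
  "bicomplete (_ :: 'm itself) L1 L2 \<U> \<longleftrightarrow>
     quasi_uniform_biframe L1 L2 \<U> \<and>
     (\<forall>(M1 :: 'm set) M2 \<V> f.
        quasi_uniform_biframe M1 M2 \<V> \<and>
        quasi_uniform_surjection M1 M2 \<V> L1 L2 \<U> f \<and> dense_hom f \<longrightarrow>
        quasi_uniform_iso M1 M2 \<V> L1 L2 \<U> f)"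


section \<open>The well-monotone quasi-uniformity\<close>

definition well_ordered_cover :: "'a::frame set \<Rightarrow> 'a set \<Rightarrow> bool" where
  "well_ordered_cover L1 A \<longleftrightarrow>
     A \<subseteq> L1 \<and> Sup A = top \<and> well_order_on A (relation_of (\<le>) A)"

text \<open>The intersection is taken in \<open>L1 \<times> L2\<close>, which matters only for empty \<open>A\<close>.\<close>

definition C_cover :: "'a::frame set \<Rightarrow> 'a set \<Rightarrow> 'a set \<Rightarrow> ('a \<times> 'a) set" where
  "C_cover L1 L2 A = (L1 \<times> L2) \<inter> (\<Inter>a\<in>A. down L1 L2 {(a, top)} \<union> down L1 L2 {(top, frame_compl a)})"

definition C_cover_strong :: "'a::frame set \<Rightarrow> 'a set \<Rightarrow> 'a set \<Rightarrow> ('a \<times> 'a) set" where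
  "C_cover_strong L1 L2 A = down L1 L2 {(x, y) \<in> C_cover L1 L2 A. inf x y \<noteq> bot}"

text \<open>The smallest quasi-uniformity containing the given paircovers, as the intersection of all
  of them; meant for strictly zero-dimensional \<open>(L1, L2)\<close>.\<close>

definition well_monotone :: "'a::frame set \<Rightarrow> 'a set \<Rightarrow> ('a \<times> 'a) set set" where
  "well_monotone L1 L2 =
     quasi_uniformity L1 L2 hull {C_cover_strong L1 L2 A | A. well_ordered_cover L1 A}"


section \<open>The congruence biframe\<close>

definition frame_congruence :: "('a::frame \<times> 'a) set \<Rightarrow> bool" where
  "frame_congruence \<theta> \<longleftrightarrow> equiv UNIV \<theta> \<and> subframe \<theta>"

lemma subframe_prod_iff:
  fixes S :: "('a::frame \<times> 'b::frame) set"
  shows "subframe S \<longleftrightarrow> (top, top) \<in> S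
    \<and> (\<forall>x y x' y'. (x, y) \<in> S \<longrightarrow> (x', y') \<in> S \<longrightarrow> (inf x x', inf y y') \<in> S)
    \<and> (\<forall>A. A \<subseteq> S \<longrightarrow> (Sup (fst ` A), Sup (snd ` A)) \<in> S)"
  unfolding subframe_def Sup_prod_def top_prod_def by (simp add: split_paired_Ball_Sigma Ball_def)

lemma frame_congruence_iff:
  fixes \<theta> :: "('a::frame \<times> 'a) set"
  shows "frame_congruence \<theta> \<longleftrightarrow> (\<forall>x. (x, x) \<in> \<theta>) \<and> (\<forall>x y. (x, y) \<in> \<theta> \<longrightarrow> (y, x) \<in> \<theta>)
    \<and> (\<forall>x y z. (x, y) \<in> \<theta> \<longrightarrow> (y, z) \<in> \<theta> \<longrightarrow> (x, z) \<in> \<theta>)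
    \<and> (\<forall>x y x' y'. (x, y) \<in> \<theta> \<longrightarrow> (x', y') \<in> \<theta> \<longrightarrow> (inf x x', inf y y') \<in> \<theta>)
    \<and> (\<forall>A. A \<subseteq> \<theta> \<longrightarrow> (Sup (fst ` A), Sup (snd ` A)) \<in> \<theta>)"
  unfolding frame_congruence_def equiv_def refl_on_def sym_def trans_def subframe_prod_iff
  by simp (intro iffI conjI; elim conjE; (assumption | erule spec))

lemma frame_congruenceD:
  fixes \<theta> :: "('a::frame \<times> 'a) set"
  assumes "frame_congruence \<theta>"
  shows "(x, x) \<in> \<theta>"
    and "(x, y) \<in> \<theta> \<Longrightarrow> (y, x) \<in> \<theta>"
    and "(x, y) \<in> \<theta> \<Longrightarrow> (y, z) \<in> \<theta> \<Longrightarrow> (x, z) \<in> \<theta>"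
    and "(x, y) \<in> \<theta> \<Longrightarrow> (x', y') \<in> \<theta> \<Longrightarrow> (inf x x', inf y y') \<in> \<theta>"
    and "A \<subseteq> \<theta> \<Longrightarrow> (Sup (fst ` A), Sup (snd ` A)) \<in> \<theta>"
proof -
  note h = assms[unfolded frame_congruence_iff]
  show "(x, x) \<in> \<theta>"
    using h[THEN conjunct1] by simp
  show "(x, y) \<in> \<theta> \<Longrightarrow> (y, x) \<in> \<theta>"
    using h[THEN conjunct2, THEN conjunct1] by simp
  show "(x, y) \<in> \<theta> \<Longrightarrow> (y, z) \<in> \<theta> \<Longrightarrow> (x, z) \<in> \<theta>"
    using h[THEN conjunct2, THEN conjunct2, THEN conjunct1, rule_format] .
  show "(x, y) \<in> \<theta> \<Longrightarrow> (x', y') \<in> \<theta> \<Longrightarrow> (inf x x', inf y y') \<in> \<theta>"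
    using h[THEN conjunct2, THEN conjunct2, THEN conjunct2, THEN conjunct1] by simp
  show "A \<subseteq> \<theta> \<Longrightarrow> (Sup (fst ` A), Sup (snd ` A)) \<in> \<theta>"
    using h[THEN conjunct2, THEN conjunct2, THEN conjunct2, THEN conjunct2] by simp
qed

lemma frame_congruenceI:
  fixes \<theta> :: "('a::frame \<times> 'a) set"
  assumes "\<And>x. (x, x) \<in> \<theta>" "\<And>x y. (x, y) \<in> \<theta> \<Longrightarrow> (y, x) \<in> \<theta>"
    "\<And>x y z. (x, y) \<in> \<theta> \<Longrightarrow> (y, z) \<in> \<theta> \<Longrightarrow> (x, z) \<in> \<theta>"
    "\<And>x y x' y'. (x, y) \<in> \<theta> \<Longrightarrow> (x', y') \<in> \<theta> \<Longrightarrow> (inf x x', inf y y') \<in> \<theta>"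
    "\<And>A. A \<noteq> {} \<Longrightarrow> A \<subseteq> \<theta> \<Longrightarrow> (Sup (fst ` A), Sup (snd ` A)) \<in> \<theta>"
  shows "frame_congruence \<theta>"
proof -
  have *: "(Sup (fst ` A), Sup (snd ` A)) \<in> \<theta>" if "A \<subseteq> \<theta>" for A
    using assms(1)[of bot] assms(5)[of A] that by (cases "A = {}") auto
  show ?thesis
    unfolding frame_congruence_iff
    by (intro conjI allI impI; (rule assms(1) | erule assms(2) | erule (1) assms(3)
          | erule (1) assms(4) | erule *))
qed

typedef (overloaded) 'a congruence = "{\<theta> :: ('a::frame \<times> 'a) set. frame_congruence \<theta>}"
  morphisms rel Congruence
proof
  show "UNIV \<in> {\<theta> :: ('a::frame \<times> 'a) set. frame_congruence \<theta>}"
    by (simp add: frame_congruence_iff)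
qed

setup_lifting type_definition_congruence

lemma frame_congruence_Inter:
  assumes "\<And>\<theta>. \<theta> \<in> T \<Longrightarrow> frame_congruence \<theta>"
  shows "frame_congruence (\<Inter>T)"
proof (rule frame_congruenceI; rule InterI)
  note D = frame_congruenceD[OF assms]
  fix \<theta> assume T: "\<theta> \<in> T"
  show "(x, x) \<in> \<theta>" for x by (rule D(1)[OF T])
  show "(y, x) \<in> \<theta>" if "(x, y) \<in> \<Inter>T" for x y
    using D(2)[OF T] that T by blast
  show "(x, z) \<in> \<theta>" if "(x, y) \<in> \<Inter>T" "(y, z) \<in> \<Inter>T" for x y z
    by (rule D(3)[OF T]) (rule InterD[OF that(1) T], rule InterD[OF that(2) T])
  show "(inf x x', inf y y') \<in> \<theta>" if "(x, y) \<in> \<Inter>T" "(x', y') \<in> \<Inter>T" for x y x' y'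
    using D(4)[OF T] that T by blast
  show "(Sup (fst ` A), Sup (snd ` A)) \<in> \<theta>" if "A \<noteq> {}" "A \<subseteq> \<Inter>T" for A
    by (rule D(5)[OF T]) (use that T in blast)
qed

instantiation congruence :: (frame) complete_lattice
begin

lift_definition less_eq_congruence :: "'a congruence \<Rightarrow> 'a congruence \<Rightarrow> bool" is "(\<subseteq>)" .
lift_definition less_congruence :: "'a congruence \<Rightarrow> 'a congruence \<Rightarrow> bool" is "(\<subset>)" .
lift_definition Inf_congruence :: "'a congruence set \<Rightarrow> 'a congruence" is "\<lambda>T. \<Inter>T"
  by (rule frame_congruence_Inter)
lift_definition inf_congruence :: "'a congruence \<Rightarrow> 'a congruence \<Rightarrow> 'a congruence" is "(\<inter>)"
  using frame_congruence_Inter[of "{_, _}"] by auto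
lift_definition top_congruence :: "'a congruence" is UNIV
  by (simp add: frame_congruence_iff)
definition Sup_congruence_def: "Sup (T :: 'a congruence set) = Inf {\<theta>. \<forall>\<phi>\<in>T. \<phi> \<le> \<theta>}"
definition sup_congruence_def: "sup (\<phi> :: 'a congruence) \<psi> = Inf {\<theta>. \<phi> \<le> \<theta> \<and> \<psi> \<le> \<theta>}"
definition bot_congruence_def: "bot = (Inf UNIV :: 'a congruence)"

instance
proof
  have Inf_lower': "Inf T \<le> \<theta>" if "\<theta> \<in> T" for T and \<theta> :: "'a congruence"
    using that by transfer blast
  have Inf_greatest': "\<theta> \<le> Inf T" if "\<And>\<phi>. \<phi> \<in> T \<Longrightarrow> \<theta> \<le> \<phi>" for T and \<theta> :: "'a congruence"
    using that by (simp add: less_eq_congruence.rep_eq Inf_congruence.rep_eq le_Inf_iff)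
  fix x y z :: "'a congruence" and A
  show "x < y \<longleftrightarrow> x \<le> y \<and> \<not> y \<le> x" by transfer blast
  show "x \<le> x" by transfer blast
  show "x \<le> y \<Longrightarrow> y \<le> z \<Longrightarrow> x \<le> z" by transfer blast
  show "x \<le> y \<Longrightarrow> y \<le> x \<Longrightarrow> x = y" by transfer blast
  show "inf x y \<le> x" "inf x y \<le> y" by (transfer; blast)+
  show "x \<le> y \<Longrightarrow> x \<le> z \<Longrightarrow> x \<le> inf y z" by transfer blast
  show "x \<le> sup x y" "y \<le> sup x y"
    unfolding sup_congruence_def by (auto intro!: Inf_greatest')
  show "y \<le> x \<Longrightarrow> z \<le> x \<Longrightarrow> sup y z \<le> x"
    unfolding sup_congruence_def by (auto intro!: Inf_lower')
  show "x \<in> A \<Longrightarrow> Inf A \<le> x" by (rule Inf_lower')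
  show "(\<And>x. x \<in> A \<Longrightarrow> z \<le> x) \<Longrightarrow> z \<le> Inf A" by (rule Inf_greatest')
  show "x \<in> A \<Longrightarrow> x \<le> Sup A"
    unfolding Sup_congruence_def by (auto intro!: Inf_greatest')
  show "(\<And>x. x \<in> A \<Longrightarrow> x \<le> z) \<Longrightarrow> Sup A \<le> z"
    unfolding Sup_congruence_def by (auto intro!: Inf_lower')
  show "Inf {} = (top :: 'a congruence)" by transfer simp
  show "Sup {} = (bot :: 'a congruence)"
    unfolding Sup_congruence_def bot_congruence_def by simp
qed

end

lemma rel_refl: "(x, x) \<in> rel \<theta>"
  and rel_sym: "(x, y) \<in> rel \<theta> \<Longrightarrow> (y, x) \<in> rel \<theta>"
  and rel_trans: "(x, y) \<in> rel \<theta> \<Longrightarrow> (y, z) \<in> rel \<theta> \<Longrightarrow> (x, z) \<in> rel \<theta>"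
  and rel_inf: "(x, y) \<in> rel \<theta> \<Longrightarrow> (x', y') \<in> rel \<theta> \<Longrightarrow> (inf x x', inf y y') \<in> rel \<theta>"
  and rel_Sup: "A \<subseteq> rel \<theta> \<Longrightarrow> (Sup (fst ` A), Sup (snd ` A)) \<in> rel \<theta>"
  by (rule frame_congruenceD[OF rel[of \<theta>, simplified]]; assumption)+

lemma rel_sup:
  assumes "(x, y) \<in> rel \<theta>" "(x', y') \<in> rel \<theta>"
  shows "(sup x x', sup y y') \<in> rel \<theta>"
  using rel_Sup[of "{(x, y), (x', y')}" \<theta>] assms by simp

lemma rel_interval:
  assumes "(x, y) \<in> rel \<theta>"
  shows "(inf x y, sup x y) \<in> rel \<theta>"
proof -
  have "(inf x y, y) \<in> rel \<theta>" using rel_inf[OF assms rel_refl[of y]] by simp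
  moreover have "(y, sup x y) \<in> rel \<theta>"
    using rel_sup[OF rel_sym[OF assms] rel_refl[of y]] by simp
  ultimately show ?thesis by (rule rel_trans)
qed

lemma sup_Sup_nonempty:
  fixes f :: "'i \<Rightarrow> 'a::frame"
  assumes "I \<noteq> {}"
  shows "inf (sup (SUP i\<in>I. f i) u) v = (SUP i\<in>I. inf (sup (f i) u) v)"
proof -
  have "sup (SUP i\<in>I. f i) u = (SUP i\<in>I. sup (f i) u)"
    using assms SUP_sup_distrib[where f=f and A=I and g="\<lambda>_. u"] by simp
  then show ?thesis
    using inf_Sup_frame[of v "(\<lambda>i. sup (f i) u) ` I"] by (simp add: image_image inf_commute)
qed

lift_definition cong_imp :: "'a::frame congruence \<Rightarrow> 'a congruence \<Rightarrow> 'a congruence" is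
  "\<lambda>\<phi> \<psi>. {(x, y). \<forall>(u, v)\<in>\<phi>. u \<le> v \<longrightarrow> (inf (sup x u) v, inf (sup y u) v) \<in> \<psi>}"
proof -
  fix \<phi> \<psi> :: "('a \<times> 'a) set"
  assume "frame_congruence \<psi>"
  note D = frame_congruenceD[OF this]
  let ?g = "\<lambda>x u v. inf (sup x u) v"
  let ?I = "{(x, y). \<forall>(u, v)\<in>\<phi>. u \<le> v \<longrightarrow> (?g x u v, ?g y u v) \<in> \<psi>}"
  have I: "(x, y) \<in> ?I" if "\<And>u v. (u, v) \<in> \<phi> \<Longrightarrow> u \<le> v \<Longrightarrow> (?g x u v, ?g y u v) \<in> \<psi>" for x y
    using that by blast
  have E: "(?g x u v, ?g y u v) \<in> \<psi>" if "(x, y) \<in> ?I" "(u, v) \<in> \<phi>" "u \<le> v" for x y u v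
    using that by blast
  show "frame_congruence ?I"
  proof (rule frame_congruenceI; rule I)
    fix u v assume uv: "(u, v) \<in> \<phi>" "u \<le> v"
    note E' = E[OF _ uv]
    show "(?g x u v, ?g x u v) \<in> \<psi>" for x by (rule D(1))
    show "(?g y u v, ?g x u v) \<in> \<psi>" if "(x, y) \<in> ?I" for x y
      by (rule D(2)[OF E'[OF that]])
    show "(?g x u v, ?g z u v) \<in> \<psi>" if "(x, y) \<in> ?I" "(y, z) \<in> ?I" for x y z
      by (rule D(3)[OF E'[OF that(1)] E'[OF that(2)]])
    have "?g (inf a b) u v = inf (?g a u v) (?g b u v)" for a b
      by (simp add: sup_inf_distrib2 inf_assoc inf_left_commute)
    then show "(?g (inf x x') u v, ?g (inf y y') u v) \<in> \<psi>"
      if "(x, y) \<in> ?I" "(x', y') \<in> ?I" for x y x' y'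
      using D(4)[OF E'[OF that(1)] E'[OF that(2)]] by simp
    show "(?g (Sup (fst ` A)) u v, ?g (Sup (snd ` A)) u v) \<in> \<psi>"
      if A: "A \<noteq> {}" "A \<subseteq> ?I" for A
    proof -
      have "map_prod (\<lambda>x. ?g x u v) (\<lambda>x. ?g x u v) ` A \<subseteq> \<psi>"
        using E'[OF subsetD[OF A(2)]] by auto
      from D(5)[OF this] show ?thesis
        by (simp add: sup_Sup_nonempty[OF A(1)] image_image)
    qed
  qed
qed

lemma cong_imp_iff: "inf \<phi> \<theta> \<le> \<psi> \<longleftrightarrow> \<theta> \<le> cong_imp \<phi> \<psi>"
proof
  assume *: "inf \<phi> \<theta> \<le> \<psi>"
  show "\<theta> \<le> cong_imp \<phi> \<psi>"
    unfolding less_eq_congruence.rep_eq cong_imp.rep_eq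
  proof clarify
    fix x y u v assume xy: "(x, y) \<in> rel \<theta>" and uv: "(u, v) \<in> rel \<phi>" "u \<le> v"
    have "(inf (sup x u) v, inf (sup y u) v) \<in> rel \<theta>"
      by (intro rel_inf rel_sup xy rel_refl)
    moreover have "(inf (sup z u) v, u) \<in> rel \<phi>" for z
      using rel_inf[OF rel_refl[of "sup z u"] rel_sym[OF uv(1)]] by (simp add: inf_absorb2)
    then have "(inf (sup x u) v, inf (sup y u) v) \<in> rel \<phi>"
      by (blast intro: rel_trans rel_sym)
    ultimately show "(inf (sup x u) v, inf (sup y u) v) \<in> rel \<psi>"
      using * unfolding less_eq_congruence.rep_eq inf_congruence.rep_eq by blast
  qed
next
  assume *: "\<theta> \<le> cong_imp \<phi> \<psi>"
  show "inf \<phi> \<theta> \<le> \<psi>"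
    unfolding less_eq_congruence.rep_eq inf_congruence.rep_eq
  proof clarify
    fix x y assume xy: "(x, y) \<in> rel \<phi>" "(x, y) \<in> rel \<theta>"
    have "(inf (sup x (inf x y)) (sup x y), inf (sup y (inf x y)) (sup x y)) \<in> rel \<psi>"
      using * xy(2) rel_interval[OF xy(1)]
      unfolding less_eq_congruence.rep_eq cong_imp.rep_eq by (fastforce simp: le_supI1)
    then show "(x, y) \<in> rel \<psi>"
      by (simp add: sup_absorb1 inf_absorb1)
  qed
qed

instance congruence :: (frame) frame
proof
  fix a :: "'a congruence" and B
  show "inf a (Sup B) \<le> Sup (inf a ` B)"
    unfolding cong_imp_iff
    by (rule Sup_least) (auto simp flip: cong_imp_iff intro: SUP_upper)
qed

lift_definition closed_congruence :: "'a::frame \<Rightarrow> 'a congruence" is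
  "\<lambda>a. {(x, y). sup x a = sup y a}"
proof (rule frame_congruenceI, goal_cases)
  case (5 a A)
  have "sup x a = sup y a" if "(x, y) \<in> A" for x y using 5(2) that by blast
  then have "(SUP p\<in>A. inf (sup (fst p) a) top) = (SUP p\<in>A. inf (sup (snd p) a) top)"
    by (intro SUP_cong) auto
  then show ?case
    using sup_Sup_nonempty[OF 5(1), of fst a top] sup_Sup_nonempty[OF 5(1), of snd a top] by simp
qed (auto simp: sup_inf_distrib2)

lift_definition open_congruence :: "'a::frame \<Rightarrow> 'a congruence" is
  "\<lambda>a. {(x, y). inf x a = inf y a}"
proof (rule frame_congruenceI, goal_cases)
  case (4 a x y x' y')
  then have "inf x a = inf y a" "inf x' a = inf y' a" by auto
  then have "inf (inf x a) (inf x' a) = inf (inf y a) (inf y' a)" by simp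
  then show ?case by (simp add: inf_commute inf_left_commute)
next
  case (5 a A)
  have "inf x a = inf y a" if "(x, y) \<in> A" for x y using 5(2) that by blast
  then have "(SUP p\<in>A. inf a (fst p)) = (SUP p\<in>A. inf a (snd p))"
    by (intro SUP_cong) (auto simp: inf_commute)
  then show ?case
    using inf_Sup_frame[of a "fst ` A"] inf_Sup_frame[of a "snd ` A"]
    by (simp add: image_image inf_commute)
qed auto

definition closed_part :: "'a::frame congruence set" where
  "closed_part = range closed_congruence"

definition open_part :: "'a::frame congruence set" where
  "open_part = subframe hull (range open_congruence)"

lemma complement_of_closed: "complement_of (closed_congruence a) (open_congruence a)"
proof -
  have "inf (closed_congruence a) (open_congruence a) \<le> \<theta>" for \<theta>
    unfolding less_eq_congruence.rep_eq inf_congruence.rep_eq closed_congruence.rep_eq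
      open_congruence.rep_eq
  proof clarify
    fix x y assume "sup x a = sup y a" "inf x a = inf y a"
    then have "x = y" by (metis inf_sup_absorb inf_sup_distrib1 inf_commute sup_commute)
    then show "(x, y) \<in> rel \<theta>" by (simp add: rel_refl)
  qed
  then have "inf (closed_congruence a) (open_congruence a) = bot"
    by (simp add: le_bot)
  moreover have "top \<le> sup (closed_congruence a) (open_congruence a)" (is "_ \<le> ?s")
  proof -
    have "rel (closed_congruence a) \<subseteq> rel ?s" "rel (open_congruence a) \<subseteq> rel ?s"
      by (simp_all flip: less_eq_congruence.rep_eq)
    moreover have "(bot, a) \<in> rel (closed_congruence a)" "(a, top) \<in> rel (open_congruence a)"
      by (simp_all add: closed_congruence.rep_eq open_congruence.rep_eq)
    ultimately have bt: "(bot, top) \<in> rel ?s" by (blast intro: rel_trans)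
    have "(bot, x) \<in> rel ?s" for x using rel_inf[OF rel_refl[of x] bt] by simp
    then show ?thesis
      unfolding less_eq_congruence.rep_eq by (auto intro: rel_trans rel_sym)
  qed
  ultimately show ?thesis unfolding complement_of_def by (simp add: top_le)
qed

lemma frame_compl_closed_congruence: "frame_compl (closed_congruence a) = open_congruence a"
  by (rule frame_compl_eqI[OF complement_of_closed])

lemma congruence_eq_Sup:
  "\<theta> = Sup {inf (closed_congruence b) (open_congruence a) | a b. (a, b) \<in> rel \<theta> \<and> a \<le> b}"
    (is "\<theta> = Sup ?T")
proof (rule antisym)
  show "Sup ?T \<le> \<theta>"
  proof (rule Sup_least, clarify)
    fix a b assume ab: "(a, b) \<in> rel \<theta>" "a \<le> b"
    have *: "(x, inf x y) \<in> rel \<theta>" if "sup x b = sup y b" "inf x a = inf y a" for x y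
    proof -
      have "x = sup (inf x y) (inf x b)"
        using that(1) by (metis inf_sup_absorb inf_sup_distrib1)
      moreover have "(sup (inf x y) (inf x b), sup (inf x y) (inf x a)) \<in> rel \<theta>"
        by (intro rel_sup rel_inf rel_refl rel_sym[OF ab(1)])
      moreover have "inf x a \<le> inf x y" using that(2) by (metis inf.cobounded1 le_inf_iff)
      ultimately show ?thesis by (simp add: sup_absorb1)
    qed
    show "inf (closed_congruence b) (open_congruence a) \<le> \<theta>"
      unfolding less_eq_congruence.rep_eq inf_congruence.rep_eq closed_congruence.rep_eq
        open_congruence.rep_eq
    proof clarify
      fix x y assume h: "sup x b = sup y b" "inf x a = inf y a"
      from *[OF h] *[OF h(1)[symmetric] h(2)[symmetric]] show "(x, y) \<in> rel \<theta>"
        by (metis inf_commute rel_sym rel_trans)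
    qed
  qed
next
  show "\<theta> \<le> Sup ?T"
    unfolding less_eq_congruence.rep_eq
  proof clarify
    fix x y assume xy: "(x, y) \<in> rel \<theta>"
    let ?t = "inf (closed_congruence (sup x y)) (open_congruence (inf x y))"
    have "?t \<le> Sup ?T"
      using rel_interval[OF xy] by (intro Sup_upper) (force simp: le_supI1)
    moreover have "(x, y) \<in> rel ?t"
      by (simp add: inf_congruence.rep_eq closed_congruence.rep_eq open_congruence.rep_eq
          sup_absorb2 inf_absorb2)
    ultimately show "(x, y) \<in> rel (Sup ?T)" unfolding less_eq_congruence.rep_eq by blast
  qed
qed

lemma subframe_hull: "subframe (subframe hull S)"
  unfolding hull_def subframe_def by (simp add: subset_iff)

lemma subframe_closed_part: "subframe (closed_part :: 'a::frame congruence set)"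
proof -
  have le: "closed_congruence a \<le> \<theta> \<longleftrightarrow> (bot, a) \<in> rel \<theta>" for a and \<theta> :: "'a congruence"
  proof
    assume "closed_congruence a \<le> \<theta>"
    moreover have "(bot, a) \<in> rel (closed_congruence a)" by (simp add: closed_congruence.rep_eq)
    ultimately show "(bot, a) \<in> rel \<theta>" unfolding less_eq_congruence.rep_eq by blast
  next
    assume a: "(bot, a) \<in> rel \<theta>"
    have "(x, sup x a) \<in> rel \<theta>" for x using rel_sup[OF rel_refl[of x] a] by simp
    then show "closed_congruence a \<le> \<theta>"
      unfolding less_eq_congruence.rep_eq closed_congruence.rep_eq
      by clarify (metis rel_sym rel_trans)
  qed
  have "closed_congruence top = (top :: 'a congruence)"
    by transfer auto
  moreover have "inf (closed_congruence a) (closed_congruence b) = closed_congruence (inf a b)"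
    for a b :: 'a
  proof (rule antisym)
    show "inf (closed_congruence a) (closed_congruence b) \<le> closed_congruence (inf a b)"
      by transfer (auto simp: sup_inf_distrib1)
    show "closed_congruence (inf a b) \<le> inf (closed_congruence a) (closed_congruence b)"
      by (simp add: le closed_congruence.rep_eq sup_absorb2)
  qed
  moreover have "Sup (closed_congruence ` A) = closed_congruence (Sup A)" for A :: "'a set"
  proof (rule antisym)
    show "Sup (closed_congruence ` A) \<le> closed_congruence (Sup A)"
      by (auto intro!: SUP_least simp: le closed_congruence.rep_eq sup_absorb2 Sup_upper)
    have "Pair bot ` A \<subseteq> rel (Sup (closed_congruence ` A))"
      by (auto simp flip: le intro: SUP_upper)
    from rel_Sup[OF this] have "(bot, Sup A) \<in> rel (Sup (closed_congruence ` A))"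
      by (cases "A = {}") (auto simp: image_image)
    then show "closed_congruence (Sup A) \<le> Sup (closed_congruence ` A)" by (simp add: le)
  qed
  ultimately show ?thesis
    unfolding subframe_def closed_part_def by (metis (no_types, lifting) rangeE rangeI subset_image_iff)
qed

lemma strictly_zero_dimensional_congruence:
  "strictly_zero_dimensional (closed_part :: 'a::frame congruence set) open_part"
proof -
  have "\<theta> \<in> S" if S: "subframe S" "closed_part \<union> open_part \<subseteq> S" for S and \<theta> :: "'a congruence"
  proof -
    have gen: "closed_congruence b \<in> S" "open_congruence a \<in> S" for a b
      using S(2) hull_subset[of "range open_congruence" subframe]
      unfolding closed_part_def open_part_def by blast+
    have inf: "inf \<phi> \<psi> \<in> S" if "\<phi> \<in> S" "\<psi> \<in> S" for \<phi> \<psi>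
      using S(1) that by (simp add: subframe_def)
    have Sup: "Sup T \<in> S" if "T \<subseteq> S" for T
      using S(1) that by (simp add: subframe_def)
    show ?thesis
      by (subst congruence_eq_Sup, rule Sup) (blast intro: inf gen)
  qed
  then have "subframe hull (closed_part \<union> open_part) = (UNIV :: 'a congruence set)"
    unfolding hull_def by (intro UNIV_eq_I[symmetric] InterI) blast
  then have "biframe (closed_part :: 'a congruence set) open_part"
    unfolding biframe_def using subframe_closed_part
    by (simp add: open_part_def subframe_hull)
  moreover have "frame_compl ` closed_part = range (open_congruence :: 'a \<Rightarrow> _)"
    unfolding closed_part_def by (simp add: image_image frame_compl_closed_congruence)
  moreover have "open_congruence a \<in> open_part" for a :: 'a
    using hull_subset[of "range open_congruence" subframe] unfolding open_part_def by blast
  then have "\<forall>\<theta>\<in>closed_part. \<exists>\<phi>\<in>open_part. complement_of \<theta> (\<phi> :: 'a congruence)"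
    unfolding closed_part_def using complement_of_closed by blast
  ultimately show ?thesis
    unfolding strictly_zero_dimensional_def by (simp add: open_part_def)
qed

end

theory Submission
  imports Defs
begin

text \<open>For a dense quasi-uniform surjection \<open>f\<close> from \<open>M\<close> onto \<open>L\<close>, the right adjoints \<open>k1\<close>, \<open>k2\<close> of
  \<open>f\<close> on the two parts turn every well-monotone paircover of \<open>L\<close> into a cover of \<open>M\<close>. The covers
  coming from \<open>{top, a}\<close> show that \<open>k1 a\<close> and \<open>k2 (frame_compl a)\<close> are complements, and those coming from
  \<open>A \<union> {top}\<close> with \<open>A\<close> well-ordered (or a finite union of such) show that \<open>k1\<close> preserves the join of \<open>A\<close>,
  hence all joins. Moreover the elements \<open>inf (k1 b) (k2 (frame_compl a))\<close> generate \<open>M\<close> under joins. For a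
  congruence frame, pulling the closed congruence of \<open>m\<close> back along \<open>k1\<close> recovers from \<open>f m\<close> which
  of these generators lie below \<open>m\<close>; thus \<open>f\<close> is injective and therefore an isomorphism.\<close>

section \<open>Frame distributivity, generated subframes and well-ordered chains\<close>

lemma inf_Sup_leI:
  fixes x :: "'a::frame"
  assumes "\<And>s. s \<in> S \<Longrightarrow> inf x s \<le> z"
  shows "inf x (Sup S) \<le> z"
  unfolding inf_Sup_frame using assms by (auto intro: SUP_least)

lemma inf_Sup_Sup_leI:
  fixes S T :: "'a::frame set"
  assumes "\<And>s t. s \<in> S \<Longrightarrow> t \<in> T \<Longrightarrow> inf s t \<le> z"
  shows "inf (Sup S) (Sup T) \<le> z"
proof (rule inf_Sup_leI)
  fix t assume "t \<in> T"
  then have "inf t (Sup S) \<le> z" using assms by (intro inf_Sup_leI) (simp add: inf_commute)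
  then show "inf (Sup S) t \<le> z" by (simp add: inf_commute)
qed

text \<open>Frame distributivity rewrites the meet of two joins from \<open>G\<close> as a join of
  pairwise meets, which stay in \<open>G\<close>. It serves to show that a meet-closed set of
  generators yields everything by joins alone.\<close>

lemma subframe_joins:
  fixes G :: "'a::frame set"
  assumes "top \<in> G" and inf: "\<And>x y. x \<in> G \<Longrightarrow> y \<in> G \<Longrightarrow> inf x y \<in> G"
  shows "subframe {x. x \<le> Sup {g \<in> G. g \<le> x}}"
  unfolding subframe_def
proof (intro conjI ballI allI impI; (elim CollectE)?; rule CollectI)
  show "top \<le> Sup {g \<in> G. g \<le> top}" using assms(1) by (intro Sup_upper) simp
next
  fix x y assume x: "x \<le> Sup {g \<in> G. g \<le> x}" and y: "y \<le> Sup {g \<in> G. g \<le> y}"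
  have "inf x y \<le> inf (Sup {g \<in> G. g \<le> x}) (Sup {g \<in> G. g \<le> y})" using x y by (rule inf_mono)
  also have "\<dots> \<le> Sup {g \<in> G. g \<le> inf x y}"
    by (intro inf_Sup_Sup_leI Sup_upper) (auto intro: inf le_infI1 le_infI2)
  finally show "inf x y \<le> Sup {g \<in> G. g \<le> inf x y}" .
next
  fix A assume A: "A \<subseteq> {x. x \<le> Sup {g \<in> G. g \<le> x}}"
  show "Sup A \<le> Sup {g \<in> G. g \<le> Sup A}"
  proof (rule Sup_least)
    fix a assume a: "a \<in> A"
    then have "a \<le> Sup {g \<in> G. g \<le> a}" using A by blast
    also have "\<dots> \<le> Sup {g \<in> G. g \<le> Sup A}"
      using Sup_upper[OF a] by (intro Sup_subset_mono) (auto intro: order_trans)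
    finally show "a \<le> Sup {g \<in> G. g \<le> Sup A}" .
  qed
qed

lemma subframeD:
  assumes "subframe S"
  shows "top \<in> S" "bot \<in> S"
    and "x \<in> S \<Longrightarrow> y \<in> S \<Longrightarrow> inf x y \<in> S"
    and "x \<in> S \<Longrightarrow> y \<in> S \<Longrightarrow> sup x y \<in> S"
    and "A \<subseteq> S \<Longrightarrow> Sup A \<in> S"
proof -
  show Sup: "Sup A \<in> S" if "A \<subseteq> S" for A using assms that by (simp add: subframe_def)
  show "bot \<in> S" using Sup[of "{}"] by simp
  show "sup x y \<in> S" if "x \<in> S" "y \<in> S" using Sup[of "{x, y}"] that by simp
qed (use assms in \<open>simp_all add: subframe_def\<close>)

lemma subframe_hull_least: "S \<subseteq> T \<Longrightarrow> subframe T \<Longrightarrow> subframe hull S \<subseteq> T"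
  unfolding hull_def by blast

text \<open>Two-element subsets give totality, so well-ordered chains can be handled through least
  elements alone.\<close>

lemma well_order_on_le_iff:
  fixes A :: "'a::order set"
  shows "well_order_on A (relation_of (\<le>) A) \<longleftrightarrow> (\<forall>S\<subseteq>A. S \<noteq> {} \<longrightarrow> (\<exists>m\<in>S. \<forall>x\<in>S. m \<le> x))"
proof (intro iffI allI impI)
  let ?r = "relation_of (\<le>) A"
  fix S assume wo: "well_order_on A ?r" and S: "S \<subseteq> A" "S \<noteq> {}"
  from wo have "wf (?r - Id)" and tot: "total_on A ?r"
    by (auto simp: well_order_on_def linear_order_on_def)
  then obtain m where m: "m \<in> S" "\<And>y. (y, m) \<in> ?r - Id \<Longrightarrow> y \<notin> S"
    using S(2) by (metis ex_in_conv wfE_min)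
  have "m \<le> x" if "x \<in> S" for x
  proof -
    have "x \<in> A" "m \<in> A" using that m(1) S(1) by auto
    with m(2)[of x] that tot show ?thesis
      unfolding total_on_def relation_of_def by (cases "x = m") auto
  qed
  with m(1) show "\<exists>m\<in>S. \<forall>x\<in>S. m \<le> x" by blast
next
  let ?r = "relation_of (\<le>) A"
  assume least: "\<forall>S\<subseteq>A. S \<noteq> {} \<longrightarrow> (\<exists>m\<in>S. \<forall>x\<in>S. m \<le> x)"
  have "x \<le> y \<or> y \<le> x" if "x \<in> A" "y \<in> A" for x y
    using least[rule_format, of "{x, y}"] that by auto
  then have "total_on A ?r" by (auto simp: total_on_def relation_of_def)
  moreover have "wf (?r - Id)"
  proof (rule wfI_min)
    fix x Q assume x: "x \<in> (Q :: 'a set)"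
    show "\<exists>z\<in>Q. \<forall>y. (y, z) \<in> ?r - Id \<longrightarrow> y \<notin> Q"
    proof (cases "Q \<inter> A = {}")
      case True
      then show ?thesis using x by (auto simp: relation_of_def)
    next
      case False
      then obtain m where "m \<in> Q \<inter> A" "\<forall>y\<in>Q \<inter> A. m \<le> y"
        using least[rule_format, of "Q \<inter> A"] by blast
      then show ?thesis by (intro bexI[of _ m]) (auto simp: relation_of_def intro: antisym)
    qed
  qed
  ultimately show "well_order_on A ?r"
    unfolding well_order_on_def linear_order_on_def partial_order_on_def preorder_on_def
    by (auto simp: refl_on_def trans_def antisym_def relation_of_def)
qed

lemma well_order_on_le_leastE:
  fixes A :: "'a::order set"
  assumes wo: "well_order_on A (relation_of (\<le>) A)" and "a \<in> A" "P a"
  obtains m where "m \<in> A" "P m" "\<And>x. x \<in> A \<Longrightarrow> P x \<Longrightarrow> m \<le> x"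
proof -
  have "{x \<in> A. P x} \<subseteq> A" "{x \<in> A. P x} \<noteq> {}" using assms by auto
  then have "\<exists>m\<in>{x \<in> A. P x}. \<forall>x\<in>{x \<in> A. P x}. m \<le> x"
    using wo unfolding well_order_on_le_iff by (elim allE impE)
  then show thesis using that by blast
qed

text \<open>A chain with arbitrary join becomes a cover once \<open>top\<close> is adjoined. The
  least element is taken inside \<open>A\<close> whenever the subset meets \<open>A\<close>.\<close>

lemma well_order_on_insert_top:
  fixes A :: "'a::order_top set"
  assumes "well_order_on A (relation_of (\<le>) A)"
  shows "well_order_on (insert top A) (relation_of (\<le>) (insert top A))"
  unfolding well_order_on_le_iff
proof (intro allI impI)
  fix S assume S: "S \<subseteq> insert top A" "S \<noteq> {}"
  show "\<exists>m\<in>S. \<forall>x\<in>S. m \<le> x"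
  proof (cases "S \<inter> A = {}")
    case True
    then have "S = {top}" using S by blast
    then show ?thesis by simp
  next
    case False
    then obtain m where "m \<in> S \<inter> A" "\<forall>x\<in>S \<inter> A. m \<le> x"
      using assms[unfolded well_order_on_le_iff, rule_format, of "S \<inter> A"] by blast
    then show ?thesis using S by (intro bexI[of _ m]) auto
  qed
qed


section \<open>Paircovers and stars\<close>

lemma down_subset: "down L1 L2 U \<subseteq> L1 \<times> L2"
  unfolding down_def by blast

lemma downset_leD:
  "downset L1 L2 U \<Longrightarrow> (x, y) \<in> U \<Longrightarrow> u \<in> L1 \<Longrightarrow> v \<in> L2 \<Longrightarrow> u \<le> x \<Longrightarrow> v \<le> y \<Longrightarrow> (u, v) \<in> U"
  unfolding downset_def by fastforce

lemma downsetI: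
  assumes "U \<subseteq> L1 \<times> L2"
    and "\<And>x y u v. (x, y) \<in> U \<Longrightarrow> u \<in> L1 \<Longrightarrow> v \<in> L2 \<Longrightarrow> u \<le> x \<Longrightarrow> v \<le> y \<Longrightarrow> (u, v) \<in> U"
  shows "downset L1 L2 U"
  unfolding downset_def using assms by auto

lemma downset_down: "downset L1 L2 (down L1 L2 U)"
  unfolding down_def downset_def by (blast intro: order_trans)

lemma down_subset_downset: "downset L1 L2 U \<Longrightarrow> G \<subseteq> U \<Longrightarrow> down L1 L2 G \<subseteq> U"
  unfolding down_def downset_def by blast

lemma subset_down: "U \<subseteq> L1 \<times> L2 \<Longrightarrow> U \<subseteq> down L1 L2 U"
  unfolding down_def by auto

lemma paircover_subset: "paircover L1 L2 U \<Longrightarrow> U \<subseteq> L1 \<times> L2"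
  unfolding paircover_def downset_def by blast

text \<open>The meets \<open>inf u v\<close> join to \<open>top\<close>, so by distributivity
  \<open>x\<close> is the join of its meets with them, and zero meets contribute nothing.\<close>

lemma le_paircoverI:
  assumes "paircover L1 L2 U"
    and "\<And>u v. (u, v) \<in> U \<Longrightarrow> inf x (inf u v) \<noteq> bot \<Longrightarrow> inf x (inf u v) \<le> z"
  shows "x \<le> z"
proof -
  have "inf x (SUP (u, v)\<in>U. inf u v) \<le> z"
    by (rule inf_Sup_leI) (use assms(2) in fastforce)
  then show ?thesis using assms(1) by (simp add: paircover_def)
qed

lemma paircover_mono:
  assumes "paircover L1 L2 U" "U \<subseteq> V" "downset L1 L2 V"
  shows "paircover L1 L2 V"
  unfolding paircover_def
proof
  have "(SUP (u, v)\<in>U. inf u v) \<le> (SUP (u, v)\<in>V. inf u v)"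
    by (rule SUP_subset_mono[OF assms(2)]) simp
  then show "(SUP (u, v)\<in>V. inf u v) = top"
    using assms(1) by (simp add: paircover_def top_le)
qed (rule assms(3))

lemma paircover_UNIV:
  assumes "subframe L1" "subframe L2"
  shows "paircover L1 L2 (L1 \<times> L2)"
proof -
  have "top \<le> (SUP (u, v)\<in>L1 \<times> L2. inf u v)"
    by (rule Sup_upper2[of top])
      (use subframeD(1)[OF assms(1)] subframeD(1)[OF assms(2)] in \<open>auto simp: image_iff intro!: bexI[of _ "(top, top)"]\<close>)
  then show ?thesis unfolding paircover_def downset_def by (auto simp: top_le)
qed

text \<open>For \<open>(x, y)\<close> in \<open>U\<close> and \<open>(u, v)\<close> in
  \<open>V\<close>, the pair \<open>(inf x u, inf y v)\<close> lies in both downsets, and the meets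
  of these pairs still join to \<open>top\<close>.\<close>

lemma paircover_Int:
  assumes "subframe L1" "subframe L2" and U: "paircover L1 L2 U" and V: "paircover L1 L2 V"
  shows "paircover L1 L2 (U \<inter> V)"
proof -
  have dn: "downset L1 L2 U" "downset L1 L2 V" using U V by (auto simp: paircover_def)
  have "inf x y \<le> (SUP (u, v)\<in>U \<inter> V. inf u v)" if "(x, y) \<in> U" for x y
  proof (rule le_paircoverI[OF V])
    fix u v assume "(u, v) \<in> V"
    then have "(inf x u, inf y v) \<in> U \<inter> V"
      using that subframeD(3)[OF assms(1), of x u] subframeD(3)[OF assms(2), of y v]
        downset_leD[OF dn(1), of x y "inf x u" "inf y v"]
        downset_leD[OF dn(2), of u v "inf x u" "inf y v"]
        paircover_subset[OF U] paircover_subset[OF V] by auto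
    then show "inf (inf x y) (inf u v) \<le> (SUP (u, v)\<in>U \<inter> V. inf u v)"
      by (intro Sup_upper2[of "inf (inf x u) (inf y v)"]) (force simp: ac_simps intro: le_infI1 le_infI2)+
  qed
  then have "(SUP (u, v)\<in>U. inf u v) \<le> (SUP (u, v)\<in>U \<inter> V. inf u v)"
    by (auto intro: SUP_least)
  then have "(SUP (u, v)\<in>U \<inter> V. inf u v) = top" using U by (simp add: paircover_def top_le)
  moreover have "downset L1 L2 (U \<inter> V)" using dn unfolding downset_def by blast
  ultimately show ?thesis by (simp add: paircover_def)
qed

lemma paircover_filterD:
  assumes "paircover_filter L1 L2 \<U>"
  shows "U \<in> \<U> \<Longrightarrow> paircover L1 L2 U"
    and "U \<in> \<U> \<Longrightarrow> paircover L1 L2 V \<Longrightarrow> U \<subseteq> V \<Longrightarrow> V \<in> \<U>"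
    and "U \<in> \<U> \<Longrightarrow> V \<in> \<U> \<Longrightarrow> U \<inter> V \<in> \<U>"
    and "\<U> \<noteq> {}"
  using assms unfolding paircover_filter_def by meson+

section \<open>Stars of elements with respect to a paircover\<close>

lemma st1_leI: "(\<And>u v. (u, v) \<in> U \<Longrightarrow> inf x v \<noteq> bot \<Longrightarrow> u \<le> z) \<Longrightarrow> st1 x U \<le> z"
  unfolding st1_def by (auto intro: Sup_least)

lemma st2_leI: "(\<And>u v. (u, v) \<in> U \<Longrightarrow> inf x u \<noteq> bot \<Longrightarrow> v \<le> z) \<Longrightarrow> st2 x U \<le> z"
  unfolding st2_def by (auto intro: Sup_least)

lemma le_st1: "(u, v) \<in> U \<Longrightarrow> inf x v \<noteq> bot \<Longrightarrow> u \<le> st1 x U"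
  unfolding st1_def by (auto intro: Sup_upper)

lemma le_st2: "(u, v) \<in> U \<Longrightarrow> inf x u \<noteq> bot \<Longrightarrow> v \<le> st2 x U"
  unfolding st2_def by (auto intro: Sup_upper)

lemma inf_neq_bot_mono: "inf x y \<noteq> bot \<Longrightarrow> x \<le> x' \<Longrightarrow> y \<le> y' \<Longrightarrow> inf x' y' \<noteq> (bot :: 'a::frame)"
  using inf_mono[of x x' y y'] le_bot by fastforce

lemma st1_mono: "x \<le> y \<Longrightarrow> st1 x U \<le> st1 y U"
  by (rule st1_leI) (erule le_st1, erule (1) inf_neq_bot_mono, rule order_refl)

lemma st2_mono: "x \<le> y \<Longrightarrow> st2 x U \<le> st2 y U"
  by (rule st2_leI) (erule le_st2, erule (1) inf_neq_bot_mono, rule order_refl)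

lemma st1_mem: "subframe L1 \<Longrightarrow> U \<subseteq> L1 \<times> L2 \<Longrightarrow> st1 x U \<in> L1"
  unfolding st1_def by (rule subframeD(5)) auto

lemma st2_mem: "subframe L2 \<Longrightarrow> U \<subseteq> L1 \<times> L2 \<Longrightarrow> st2 x U \<in> L2"
  unfolding st2_def by (rule subframeD(5)) auto

text \<open>If \<open>x\<close> meets \<open>inf u v\<close>, it meets \<open>v\<close>, so
  \<open>u\<close> is one of the joinands of the star.\<close>

lemma le_st1_self:
  assumes "paircover L1 L2 U"
  shows "x \<le> st1 x U"
proof (rule le_paircoverI[OF assms])
  fix u v assume uv: "(u, v) \<in> U" "inf x (inf u v) \<noteq> bot"
  then have "inf x v \<noteq> bot" by (metis inf_bot_right inf_left_commute)
  with uv(1) show "inf x (inf u v) \<le> st1 x U" by (intro le_infI2 le_infI1) (rule le_st1)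
qed

lemma le_st2_self:
  assumes "paircover L1 L2 U"
  shows "x \<le> st2 x U"
proof (rule le_paircoverI[OF assms])
  fix u v assume uv: "(u, v) \<in> U" "inf x (inf u v) \<noteq> bot"
  then have "inf x u \<noteq> bot" by (metis inf_bot_left inf_assoc)
  with uv(1) show "inf x (inf u v) \<le> st2 x U" by (intro le_infI2) (rule le_st2)
qed


section \<open>The well-monotone quasi-uniformity\<close>

lemma well_ordered_cover_insert_top:
  assumes "subframe L1" "A \<subseteq> L1" "well_order_on A (relation_of (\<le>) A)"
  shows "well_ordered_cover L1 (insert top A)"
  using assms subframeD(1)[OF assms(1)] well_order_on_insert_top
  unfolding well_ordered_cover_def by auto

text \<open>The union of two well-ordered covers need not be a chain, but \<open>C_cover\<close>
  turns unions of index sets into intersections, so finite unions index a filter base. The empty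
  family is allowed and yields the paircover \<open>L1 \<times> L2\<close>.\<close>

definition finite_union_cover :: "'a::frame set \<Rightarrow> 'a set \<Rightarrow> bool" where
  "finite_union_cover L1 A \<longleftrightarrow> (\<exists>\<F>. finite \<F> \<and> (\<forall>B\<in>\<F>. well_ordered_cover L1 B) \<and> A = \<Union>\<F>)"

lemma finite_union_cover_Un:
  "finite_union_cover L1 A \<Longrightarrow> finite_union_cover L1 B \<Longrightarrow> finite_union_cover L1 (A \<union> B)"
  unfolding finite_union_cover_def by (metis Un_iff Union_Un_distrib finite_Un)

lemma finite_union_cover_subset: "finite_union_cover L1 A \<Longrightarrow> A \<subseteq> L1"
  unfolding finite_union_cover_def well_ordered_cover_def by blast

lemma finite_union_cover_insert_top:
  assumes "subframe L1" "A \<subseteq> L1" "well_order_on A (relation_of (\<le>) A)"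
  shows "finite_union_cover L1 (insert top A)"
  unfolding finite_union_cover_def
  using well_ordered_cover_insert_top[OF assms] by (intro exI[of _ "{insert top A}"]) simp

text \<open>The associated paircover consists of the pairs below \<open>(a, top)\<close> or
  \<open>(top, frame_compl a)\<close>; it separates \<open>a\<close> from its complement.\<close>

lemma finite_union_cover_pair: "subframe L1 \<Longrightarrow> a \<in> L1 \<Longrightarrow> finite_union_cover L1 {top, a}"
  by (rule finite_union_cover_insert_top) (auto simp: well_order_on_le_iff subset_singleton_iff)

text \<open>The explicit form of the generated quasi-uniformity; \<open>well_monotone_eq\<close>
  proves that the two agree.\<close>

definition well_monotone_base :: "'a::frame set \<Rightarrow> 'a set \<Rightarrow> ('a \<times> 'a) set set" where
  "well_monotone_base L1 L2 =
     {U. paircover L1 L2 U \<and> (\<exists>A. finite_union_cover L1 A \<and> C_cover_strong L1 L2 A \<subseteq> U)}"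

section \<open>Complements in a strictly zero-dimensional biframe\<close>

locale szd_biframe =
  fixes L1 L2 :: "'a::frame set"
  assumes szd: "strictly_zero_dimensional L1 L2"
begin

lemma sub1: "subframe L1" and sub2: "subframe L2" and generate: "subframe hull (L1 \<union> L2) = UNIV"
  using szd unfolding strictly_zero_dimensional_def biframe_def by auto

lemma complement_of_frame_compl: "a \<in> L1 \<Longrightarrow> complement_of a (frame_compl a)"
  and compl_mem: "a \<in> L1 \<Longrightarrow> frame_compl a \<in> L2"
  using szd frame_compl_eqI unfolding strictly_zero_dimensional_def by metis+

lemma inf_compl: "a \<in> L1 \<Longrightarrow> inf a (frame_compl a) = bot"
  and sup_compl: "a \<in> L1 \<Longrightarrow> sup a (frame_compl a) = top"
  using complement_of_frame_compl unfolding complement_of_def by auto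

lemma le_compl_iff:
  assumes "a \<in> L1"
  shows "y \<le> frame_compl a \<longleftrightarrow> inf y a = bot"
proof
  assume "y \<le> frame_compl a"
  then have "inf y a \<le> inf a (frame_compl a)" by (simp add: le_infI1)
  then show "inf y a = bot" using inf_compl[OF assms] le_bot by simp
next
  assume *: "inf y a = bot"
  have "y = inf y (sup a (frame_compl a))" by (simp add: sup_compl[OF assms])
  also have "\<dots> = inf y (frame_compl a)" by (simp add: inf_sup_distrib1 *)
  finally show "y \<le> frame_compl a" by (simp add: le_iff_inf)
qed

text \<open>Read as disjointness, this is distributivity over arbitrary joins: an infinite de Morgan
  law stated through lower bounds.\<close>

lemma le_compl_Sup_iff:
  assumes "A \<subseteq> L1"
  shows "y \<le> frame_compl (Sup A) \<longleftrightarrow> (\<forall>a\<in>A. y \<le> frame_compl a)"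
proof -
  have "Sup A \<in> L1" using sub1 assms by (rule subframeD(5))
  moreover have "inf y (Sup A) = bot \<longleftrightarrow> (\<forall>a\<in>A. inf y a = bot)"
    unfolding inf_Sup_frame by (auto simp: SUP_eq_iff bot_unique)
  ultimately show ?thesis using assms by (auto simp: le_compl_iff subset_iff)
qed

lemma compl_sup:
  assumes "a \<in> L1" "b \<in> L1"
  shows "frame_compl (sup a b) = inf (frame_compl a) (frame_compl b)"
  using le_compl_Sup_iff[of "{a, b}"] assms
  by (intro antisym) (auto simp: le_inf_iff)

lemma compl_bot: "frame_compl bot = top"
  by (rule frame_compl_eqI) (simp add: complement_of_def)

lemma compl_antimono: "a \<in> L1 \<Longrightarrow> b \<in> L1 \<Longrightarrow> a \<le> b \<Longrightarrow> frame_compl b \<le> frame_compl a"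
  using compl_sup[of a b] by (simp add: sup_absorb2 le_iff_inf inf_commute)

text \<open>Complements are closed under finite meets by \<open>compl_bot\<close> and
  \<open>compl_sup\<close>, so their joins already form a subframe, and \<open>L2\<close> is the
  least subframe containing them.\<close>

lemma join_of_compl:
  assumes "x \<in> L2"
  shows "x \<le> Sup {y \<in> frame_compl ` L1. y \<le> x}"
proof -
  have "subframe {x. x \<le> Sup {y \<in> frame_compl ` L1. y \<le> x}}"
  proof (rule subframe_joins)
    show "top \<in> frame_compl ` L1" using compl_bot subframeD(2)[OF sub1] by (metis imageI)
    show "inf x y \<in> frame_compl ` L1" if "x \<in> frame_compl ` L1" "y \<in> frame_compl ` L1" for x y
      using that compl_sup subframeD(4)[OF sub1] by (auto simp: image_iff) metis
  qed
  moreover have "frame_compl ` L1 \<subseteq> {x. x \<le> Sup {y \<in> frame_compl ` L1. y \<le> x}}"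
    by (auto intro: Sup_upper)
  ultimately have "subframe hull (frame_compl ` L1) \<subseteq> {x. x \<le> Sup {y \<in> frame_compl ` L1. y \<le> x}}"
    by (intro subframe_hull_least)
  then show ?thesis using assms szd unfolding strictly_zero_dimensional_def by blast
qed

section \<open>The paircovers attached to a subset of the first part\<close>

lemma C_cover_iff:
  assumes "A \<subseteq> L1"
  shows "(x, y) \<in> C_cover L1 L2 A \<longleftrightarrow>
    x \<in> L1 \<and> y \<in> L2 \<and> (\<forall>a\<in>A. x \<le> a \<or> y \<le> frame_compl a)"
  unfolding C_cover_def down_def by (auto simp: less_eq_prod_def)

lemma downset_C_cover:
  assumes "A \<subseteq> L1"
  shows "downset L1 L2 (C_cover L1 L2 A)"
proof (rule downsetI)
  show "C_cover L1 L2 A \<subseteq> L1 \<times> L2" unfolding C_cover_def by blast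
  show "(u, v) \<in> C_cover L1 L2 A"
    if "(x, y) \<in> C_cover L1 L2 A" "u \<in> L1" "v \<in> L2" "u \<le> x" "v \<le> y" for x y u v
    using that unfolding C_cover_iff[OF assms] by (meson order_trans)
qed

lemma C_cover_Un: "C_cover L1 L2 (A \<union> B) = C_cover L1 L2 A \<inter> C_cover L1 L2 B"
  unfolding C_cover_def by blast

lemma C_cover_strong_mono: "A \<subseteq> B \<Longrightarrow> C_cover_strong L1 L2 B \<subseteq> C_cover_strong L1 L2 A"
proof -
  assume "A \<subseteq> B"
  then have "C_cover L1 L2 B \<subseteq> C_cover L1 L2 A" unfolding C_cover_def by blast
  then show ?thesis unfolding C_cover_strong_def down_def by blast
qed

lemma C_cover_strong_subset:
  assumes "A \<subseteq> L1"
  shows "C_cover_strong L1 L2 A \<subseteq> C_cover L1 L2 A"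
  unfolding C_cover_strong_def by (rule down_subset_downset[OF downset_C_cover[OF assms]]) auto

lemma C_cover_strongI: "(x, y) \<in> C_cover L1 L2 A \<Longrightarrow> inf x y \<noteq> bot \<Longrightarrow> (x, y) \<in> C_cover_strong L1 L2 A"
  unfolding C_cover_strong_def down_def by (auto simp: C_cover_def)

text \<open>By well-founded induction every \<open>a \<in> A\<close> lies below the join of the \<open>inf x y\<close>: with
  \<open>c\<close> the join of the predecessors of \<open>a\<close>, the pair \<open>(a, frame_compl c)\<close> belongs to \<open>C_cover L1 L2 A\<close>.\<close>

lemma paircover_C_cover:
  assumes "well_ordered_cover L1 A"
  shows "paircover L1 L2 (C_cover L1 L2 A)"
proof -
  have A: "A \<subseteq> L1" "Sup A = top" and wo: "well_order_on A (relation_of (\<le>) A)"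
    using assms by (auto simp: well_ordered_cover_def)
  define s where "s = (SUP (x, y)\<in>C_cover L1 L2 A. inf x y)"
  have "a \<le> s" if a: "a \<in> A" for a
  proof (rule ccontr)
    assume "\<not> a \<le> s"
    then obtain b where b: "b \<in> A" "\<not> b \<le> s" and least: "\<And>x. x \<in> A \<Longrightarrow> \<not> x \<le> s \<Longrightarrow> b \<le> x"
      using well_order_on_le_leastE[OF wo a, of "\<lambda>x. \<not> x \<le> s"] by blast
    define c where "c = Sup {x \<in> A. \<not> b \<le> x}"
    have c: "c \<in> L1" unfolding c_def using A(1) by (intro subframeD(5)[OF sub1]) blast
    \<comment> \<open>By minimality of \<open>b\<close>, members of \<open>A\<close> that are not
      above \<open>b\<close> lie below \<open>s\<close>.\<close>
    have "c \<le> s" unfolding c_def using least by (auto intro: Sup_least)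
    have "frame_compl c \<le> frame_compl x" if "x \<in> A" "\<not> b \<le> x" for x
      using that A(1) c by (intro compl_antimono) (auto simp: c_def intro: Sup_upper)
    then have "(b, frame_compl c) \<in> C_cover L1 L2 A"
      unfolding C_cover_iff[OF A(1)] using b(1) A(1) compl_mem[OF c] by auto
    then have "inf b (frame_compl c) \<le> s" unfolding s_def by (force intro: Sup_upper)
    \<comment> \<open>Split \<open>b\<close> along \<open>c\<close> and its complement: one piece
      lies below \<open>c\<close>, the other comes from a pair of the cover.\<close>
    with \<open>c \<le> s\<close> have "sup (inf b c) (inf b (frame_compl c)) \<le> s" by (simp add: le_infI2)
    then show False using b(2) by (simp flip: inf_sup_distrib1 add: sup_compl[OF c])
  qed
  then have "Sup A \<le> s" by (rule Sup_least)
  then show ?thesis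
    unfolding paircover_def s_def[symmetric] using A downset_C_cover[OF A(1)] by (simp add: top_le)
qed

lemma paircover_C_cover_finite_union:
  assumes "finite_union_cover L1 A"
  shows "paircover L1 L2 (C_cover L1 L2 A)"
proof -
  from assms obtain \<F> where "finite \<F>" "\<forall>B\<in>\<F>. well_ordered_cover L1 B" "A = \<Union>\<F>"
    unfolding finite_union_cover_def by blast
  then show ?thesis
  proof (induction \<F> arbitrary: A)
    case empty
    then show ?case using paircover_UNIV[OF sub1 sub2] by (simp add: C_cover_def)
  next
    case (insert B \<F>)
    then show ?case
      by (simp add: C_cover_Un paircover_Int[OF sub1 sub2] paircover_C_cover)
  qed
qed

text \<open>Discarding pairs with zero meet does not change the join.\<close>

lemma paircover_C_cover_strong:
  assumes "finite_union_cover L1 A"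
  shows "paircover L1 L2 (C_cover_strong L1 L2 A)"
proof -
  let ?s = "SUP (x, y)\<in>C_cover_strong L1 L2 A. inf x y"
  have "top \<le> ?s"
  proof (rule le_paircoverI[OF paircover_C_cover_finite_union[OF assms]])
    fix x y assume "(x, y) \<in> C_cover L1 L2 A" "inf top (inf x y) \<noteq> bot"
    then have "(x, y) \<in> C_cover_strong L1 L2 A" by (simp add: C_cover_strongI)
    then show "inf top (inf x y) \<le> ?s" by (force intro: Sup_upper)
  qed
  then show ?thesis
    unfolding paircover_def C_cover_strong_def using downset_down by (auto simp: top_le)
qed

lemma strong_C_cover_strong: "strong L1 L2 (C_cover_strong L1 L2 A)"
  unfolding strong_def C_cover_strong_def
  by (intro exI[of _ "{(x, y) \<in> C_cover L1 L2 A. inf x y \<noteq> bot}"]) (auto simp: C_cover_def)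

text \<open>This paircover is its own star refinement. If \<open>x \<le> a\<close>, a pair whose
  second component meets \<open>x\<close> cannot have it below \<open>frame_compl a\<close>, so its
  first component lies below \<open>a\<close>; the other case is dual.\<close>

lemma star_C_cover_strong:
  assumes A: "A \<subseteq> L1"
  shows "star L1 L2 (C_cover_strong L1 L2 A) \<subseteq> C_cover_strong L1 L2 A" (is "star L1 L2 ?U \<subseteq> _")
proof -
  have U: "?U \<subseteq> L1 \<times> L2" unfolding C_cover_strong_def by (rule down_subset)
  have UC: "x \<le> a \<or> y \<le> frame_compl a" if "(x, y) \<in> ?U" "a \<in> A" for x y a
    using C_cover_strong_subset[OF A] that C_cover_iff[OF A] by blast
  have "(st1 x ?U, st2 y ?U) \<in> ?U" if xy: "(x, y) \<in> C_cover L1 L2 A" "inf x y \<noteq> bot" for x y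
  proof (rule C_cover_strongI)
    note xyU = C_cover_strongI[OF xy]
    have "x \<le> st1 x ?U" "y \<le> st2 y ?U"
      using le_st1[OF xyU xy(2)] le_st2[OF xyU] xy(2) by (auto simp: inf_commute)
    then show "inf (st1 x ?U) (st2 y ?U) \<noteq> bot" using xy(2) by (rule inf_neq_bot_mono[rotated])
    have "st1 x ?U \<le> a \<or> st2 y ?U \<le> frame_compl a" if a: "a \<in> A" for a
    proof -
      have aL: "a \<in> L1" using a A by blast
      consider "x \<le> a" | "y \<le> frame_compl a" using UC[OF xyU a] by blast
      then show ?thesis
      proof cases
        case 1
        have "u \<le> a" if "(u, v) \<in> ?U" "inf x v \<noteq> bot" for u v
          using UC[OF that(1) a] that(2) inf_neq_bot_mono[OF that(2) 1 order_refl]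
          by (auto simp: le_compl_iff[OF aL] inf_commute)
        then show ?thesis using st1_leI[of ?U x a] by blast
      next
        case 2
        have "v \<le> frame_compl a" if "(u, v) \<in> ?U" "inf y u \<noteq> bot" for u v
          using UC[OF that(1) a] inf_neq_bot_mono[OF that(2) 2, of a] inf_compl[OF aL]
          by (auto simp: inf_commute)
        then show ?thesis using st2_leI[of ?U y "frame_compl a"] by blast
      qed
    qed
    then show "(st1 x ?U, st2 y ?U) \<in> C_cover L1 L2 A"
      using st1_mem[OF sub1 U] st2_mem[OF sub2 U] by (simp add: C_cover_iff[OF A])
  qed
  \<comment> \<open>Every member lies below a generating pair, and stars are monotone, so the
    generating pairs suffice.\<close>
  moreover have "\<exists>x' y'. (x', y') \<in> C_cover L1 L2 A \<and> inf x' y' \<noteq> bot \<and> x \<le> x' \<and> y \<le> y'"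
    if "(x, y) \<in> ?U" for x y
    using that unfolding C_cover_strong_def down_def by (auto simp: less_eq_prod_def)
  moreover have dn: "downset L1 L2 ?U" unfolding C_cover_strong_def by (rule downset_down)
  ultimately have "(st1 x ?U, st2 y ?U) \<in> ?U" if "(x, y) \<in> ?U" for x y
    using that st1_mono[of x _ ?U] st2_mono[of y _ ?U] st1_mem[OF sub1 U, of x] st2_mem[OF sub2 U, of y]
    unfolding downset_def by (metis Pair_mono mem_Sigma_iff)
  then show ?thesis
    unfolding star_def by (intro down_subset_downset[OF dn]) auto
qed

section \<open>Explicit description of the generated quasi-uniformity\<close>

lemma C_cover_strong_mem: "finite_union_cover L1 A \<Longrightarrow> C_cover_strong L1 L2 A \<in> well_monotone_base L1 L2"
  unfolding well_monotone_base_def using paircover_C_cover_strong by blast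

lemma paircover_filter_base: "paircover_filter L1 L2 (well_monotone_base L1 L2)"
  unfolding paircover_filter_def
proof (intro conjI ballI allI impI)
  show "well_monotone_base L1 L2 \<noteq> {}"
    using C_cover_strong_mem[OF finite_union_cover_pair[OF sub1 subframeD(1)[OF sub1]]] by blast
  show "V \<in> well_monotone_base L1 L2"
    if "U \<in> well_monotone_base L1 L2" "paircover L1 L2 V \<and> U \<subseteq> V" for U V
    using that unfolding well_monotone_base_def by blast
  fix U V assume "U \<in> well_monotone_base L1 L2" "V \<in> well_monotone_base L1 L2"
  then obtain A B where AB: "finite_union_cover L1 A" "C_cover_strong L1 L2 A \<subseteq> U"
      "finite_union_cover L1 B" "C_cover_strong L1 L2 B \<subseteq> V"
    and UV: "paircover L1 L2 U" "paircover L1 L2 V"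
    unfolding well_monotone_base_def by blast
  have "C_cover_strong L1 L2 (A \<union> B) \<subseteq> U \<inter> V"
    using AB C_cover_strong_mono[of A "A \<union> B"] C_cover_strong_mono[of B "A \<union> B"] by blast
  then show "U \<inter> V \<in> well_monotone_base L1 L2"
    using paircover_Int[OF sub1 sub2 UV] finite_union_cover_Un[OF AB(1,3)]
    unfolding well_monotone_base_def by blast
qed (simp add: well_monotone_base_def)

text \<open>A second component meeting \<open>a\<close> is not below \<open>frame_compl a\<close>,
  which forces the first one below \<open>a\<close>. Thus each \<open>a\<close> is its own witness
  in the admissibility condition.\<close>

lemma st1_C_cover_pair:
  assumes "a \<in> L1"
  shows "st1 a (C_cover_strong L1 L2 {top, a}) \<le> a"
proof (rule st1_leI)
  fix u v assume uv: "(u, v) \<in> C_cover_strong L1 L2 {top, a}" "inf a v \<noteq> bot"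
  have A: "{top, a} \<subseteq> L1" using assms subframeD(1)[OF sub1] by simp
  have "u \<le> a \<or> v \<le> frame_compl a"
    using uv(1) C_cover_strong_subset[OF A] C_cover_iff[OF A] by blast
  then show "u \<le> a" using uv(2) by (auto simp: le_compl_iff[OF assms] inf_commute)
qed

lemma st2_C_cover_pair:
  assumes "a \<in> L1"
  shows "st2 (frame_compl a) (C_cover_strong L1 L2 {top, a}) \<le> frame_compl a"
proof (rule st2_leI)
  fix u v assume uv: "(u, v) \<in> C_cover_strong L1 L2 {top, a}" "inf (frame_compl a) u \<noteq> bot"
  have A: "{top, a} \<subseteq> L1" using assms subframeD(1)[OF sub1] by simp
  have "u \<le> a \<or> v \<le> frame_compl a"
    using uv(1) C_cover_strong_subset[OF A] C_cover_iff[OF A] by blast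
  then show "v \<le> frame_compl a"
    using inf_neq_bot_mono[OF uv(2) order_refl, of a] inf_compl[OF assms] by (auto simp: inf_commute)
qed

lemma quasi_uniformity_base: "quasi_uniformity L1 L2 (well_monotone_base L1 L2)" (is "quasi_uniformity L1 L2 ?W")
  unfolding quasi_uniformity_def
proof (intro conjI ballI)
  fix U assume "U \<in> ?W"
  then obtain A where A: "finite_union_cover L1 A" "C_cover_strong L1 L2 A \<subseteq> U"
    unfolding well_monotone_base_def by blast
  show "\<exists>V\<in>?W. strong L1 L2 V \<and> V \<subseteq> U"
    using C_cover_strong_mem[OF A(1)] A(2) strong_C_cover_strong by blast
  show "\<exists>V\<in>?W. star L1 L2 V \<subseteq> U"
    using C_cover_strong_mem[OF A(1)] A(2) star_C_cover_strong[OF finite_union_cover_subset[OF A(1)]]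
    by blast
next
  have pc: "paircover L1 L2 U" if "U \<in> ?W" for U using that by (simp add: well_monotone_base_def)
  show "x = Sup {y \<in> L1. \<exists>U\<in>?W. st1 y U \<le> x}" if x: "x \<in> L1" for x
  proof (rule antisym)
    show "x \<le> Sup {y \<in> L1. \<exists>U\<in>?W. st1 y U \<le> x}"
      using x st1_C_cover_pair[OF x] C_cover_strong_mem[OF finite_union_cover_pair[OF sub1 x]]
      by (auto intro: Sup_upper)
    show "Sup {y \<in> L1. \<exists>U\<in>?W. st1 y U \<le> x} \<le> x"
      using le_st1_self[OF pc] by (auto intro!: Sup_least intro: order_trans)
  qed
  show "x = Sup {y \<in> L2. \<exists>U\<in>?W. st2 y U \<le> x}" if x: "x \<in> L2" for x
  proof (rule antisym)
    \<comment> \<open>In the second part only complements are known to be fixed by such a star;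
      their joins give all of \<open>L2\<close>.\<close>
    have "\<exists>U\<in>?W. st2 y U \<le> x" if "y \<in> frame_compl ` L1" "y \<le> x" for y
      using that st2_C_cover_pair C_cover_strong_mem[OF finite_union_cover_pair[OF sub1]]
      by (auto intro: order_trans)
    then have "Sup {y \<in> frame_compl ` L1. y \<le> x} \<le> Sup {y \<in> L2. \<exists>U\<in>?W. st2 y U \<le> x}"
      using compl_mem by (intro Sup_subset_mono) auto
    with join_of_compl[OF x] show "x \<le> Sup {y \<in> L2. \<exists>U\<in>?W. st2 y U \<le> x}" by (rule order_trans)
    show "Sup {y \<in> L2. \<exists>U\<in>?W. st2 y U \<le> x} \<le> x"
      using le_st2_self[OF pc] by (auto intro!: Sup_least intro: order_trans)
  qed
qed (rule paircover_filter_base)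

text \<open>Intersecting generators only yields \<open>C_cover\<close> of the union. The strongness
  axiom then provides a member inside it generated by pairs with nonzero meet, and such a member
  lies inside \<open>C_cover_strong\<close>.\<close>

lemma C_cover_strong_mem_quasi_uniformity:
  assumes \<U>: "quasi_uniformity L1 L2 \<U>"
    and gen: "\<And>A. well_ordered_cover L1 A \<Longrightarrow> C_cover_strong L1 L2 A \<in> \<U>"
    and A: "finite_union_cover L1 A"
  shows "C_cover_strong L1 L2 A \<in> \<U>"
proof -
  have flt: "paircover_filter L1 L2 \<U>"
    and strong: "\<And>U. U \<in> \<U> \<Longrightarrow> \<exists>V\<in>\<U>. strong L1 L2 V \<and> V \<subseteq> U"
    using \<U> by (auto simp: quasi_uniformity_def)
  note up = paircover_filterD(2)[OF flt] and Int = paircover_filterD(3)[OF flt]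
  obtain U0 where U0: "U0 \<in> \<U>" using paircover_filterD(4)[OF flt] by blast
  have "L1 \<times> L2 \<in> \<U>"
    by (rule up[OF U0 paircover_UNIV[OF sub1 sub2] paircover_subset[OF paircover_filterD(1)[OF flt U0]]])
  have "C_cover L1 L2 A \<in> \<U>"
  proof -
    from A obtain \<F> where "finite \<F>" "\<forall>B\<in>\<F>. well_ordered_cover L1 B" "A = \<Union>\<F>"
      unfolding finite_union_cover_def by blast
    then show ?thesis
    proof (induction \<F> arbitrary: A)
      case empty
      then show ?case using \<open>L1 \<times> L2 \<in> \<U>\<close> by (simp add: C_cover_def)
    next
      case (insert B \<F>)
      have B: "well_ordered_cover L1 B" using insert.prems by simp
      then have "C_cover L1 L2 B \<in> \<U>"
        using up[OF gen[OF B] paircover_C_cover[OF B]] C_cover_strong_subset[of B]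
        by (simp add: well_ordered_cover_def)
      with insert show ?case by (simp add: C_cover_Un Int)
    qed
  qed
  then obtain V where V: "V \<in> \<U>" "strong L1 L2 V" "V \<subseteq> C_cover L1 L2 A" using strong by blast
  then obtain G where G: "G \<subseteq> {(x, y) \<in> L1 \<times> L2. inf x y \<noteq> bot}" "V = down L1 L2 G"
    unfolding strong_def by blast
  then have "G \<subseteq> V" using subset_down[of G L1 L2] by blast
  with G(1) V(3) have "G \<subseteq> {(x, y) \<in> C_cover L1 L2 A. inf x y \<noteq> bot}" by blast
  then have "V \<subseteq> C_cover_strong L1 L2 A"
    unfolding G(2) C_cover_strong_def down_def by blast
  then show ?thesis by (rule up[OF V(1) paircover_C_cover_strong[OF A]])
qed

lemma well_monotone_eq: "well_monotone L1 L2 = well_monotone_base L1 L2"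
proof
  have "C_cover_strong L1 L2 A \<in> well_monotone_base L1 L2" if "well_ordered_cover L1 A" for A
    using that C_cover_strong_mem[of A] unfolding finite_union_cover_def
    by (metis cSup_singleton finite.emptyI finite.insertI singletonD)
  then show "well_monotone L1 L2 \<subseteq> well_monotone_base L1 L2"
    unfolding well_monotone_def hull_def using quasi_uniformity_base by blast
  show "well_monotone_base L1 L2 \<subseteq> well_monotone L1 L2"
    unfolding well_monotone_def hull_def
  proof (intro Inter_greatest, clarify)
    fix \<U> U assume \<U>: "quasi_uniformity L1 L2 \<U>" "{C_cover_strong L1 L2 A |A. well_ordered_cover L1 A} \<subseteq> \<U>"
      and "U \<in> well_monotone_base L1 L2"
    then obtain A where A: "finite_union_cover L1 A" "C_cover_strong L1 L2 A \<subseteq> U" "paircover L1 L2 U"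
      unfolding well_monotone_base_def by blast
    have "C_cover_strong L1 L2 A \<in> \<U>"
      by (rule C_cover_strong_mem_quasi_uniformity[OF \<U>(1) _ A(1)]) (use \<U>(2) in blast)
    then show "U \<in> \<U>"
      using paircover_filterD(2)[of L1 L2 \<U>] \<U>(1) A(2,3) unfolding quasi_uniformity_def by blast
  qed
qed

end


section \<open>Dense extensions\<close>

text \<open>Well-order \<open>X\<close> arbitrarily; its partial joins \<open>p x\<close> then form a well-ordered chain.\<close>

lemma Sup_le_Sup_image_well_ordered:
  fixes k :: "'a::complete_lattice \<Rightarrow> 'b::complete_lattice"
  assumes wo: "\<And>A. A \<subseteq> S \<Longrightarrow> well_order_on A (relation_of (\<le>) A) \<Longrightarrow> k (Sup A) \<le> Sup (k ` A)"
    and sup: "\<And>a b. a \<in> S \<Longrightarrow> b \<in> S \<Longrightarrow> k (sup a b) \<le> sup (k a) (k b)"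
    and Sup: "\<And>A. A \<subseteq> S \<Longrightarrow> Sup A \<in> S"
    and X: "X \<subseteq> S"
  shows "k (Sup X) \<le> Sup (k ` X)"
proof -
  obtain r where r: "well_order_on X r" using well_order_on by blast
  have wf: "wf (r - Id)" and tot: "total_on X r" and trans: "trans r" and refl: "refl_on X r"
    and dom: "r \<subseteq> X \<times> X"
    using r unfolding order_on_defs by auto
  define p where "p x = Sup {y \<in> X. (y, x) \<in> r}" for x
  have p_S: "p x \<in> S" for x unfolding p_def using X by (intro Sup) blast
  have p_mono: "p x \<le> p y" if "(x, y) \<in> r" for x y
    unfolding p_def using that trans by (intro Sup_subset_mono) (auto dest: transD)
  have le_p: "x \<le> p x" if "x \<in> X" for x
    unfolding p_def using that refl by (intro Sup_upper) (auto simp: refl_on_def)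
  \<comment> \<open>An \<open>r\<close>-minimal index with value in \<open>T\<close> gives the least
    element of \<open>T\<close>, since \<open>p\<close> is monotone along \<open>r\<close>.\<close>
  have wo_p: "well_order_on (p ` Y) (relation_of (\<le>) (p ` Y))" if Y: "Y \<subseteq> X" for Y
    unfolding well_order_on_le_iff
  proof (intro allI impI)
    fix T assume T: "T \<subseteq> p ` Y" "T \<noteq> {}"
    then obtain x where x: "x \<in> {x \<in> Y. p x \<in> T}" by blast
    obtain z where "z \<in> {x \<in> Y. p x \<in> T}"
      and min: "\<And>y. (y, z) \<in> r - Id \<Longrightarrow> y \<notin> {x \<in> Y. p x \<in> T}"
      by (rule wfE_min[OF wf x]) (rule that)
    then have z: "z \<in> Y" "p z \<in> T" by auto
    have "p z \<le> p x" if "x \<in> Y" "p x \<in> T" for x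
    proof (cases "x = z")
      case False
      then have "(z, x) \<in> r" using min[of x] that z(1) Y tot unfolding total_on_def by blast
      then show ?thesis by (rule p_mono)
    qed simp
    then show "\<exists>m\<in>T. \<forall>x\<in>T. m \<le> x" using z(2) T(1) by (intro bexI[of _ "p z"]) auto
  qed
  have "x \<in> X \<longrightarrow> k (p x) \<le> Sup (k ` X)" for x
    using wf
  proof (induction x)
    case (less x)
    show ?case
    proof
      assume x: "x \<in> X"
      \<comment> \<open>The strict predecessors of \<open>x\<close>. Writing \<open>p x\<close> as
        the join of the earlier partial joins with \<open>x\<close> treats successor and limit
        stages alike.\<close>
      define Y where "Y = {y. (y, x) \<in> r - Id}"
      have Y: "Y \<subseteq> X" unfolding Y_def using dom by blast
      have "y \<le> sup (Sup (p ` Y)) x" if y: "y \<in> X" "(y, x) \<in> r" for y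
      proof (cases "y = x")
        case False
        then have "y \<in> Y" using y unfolding Y_def by blast
        then show ?thesis using le_p[OF y(1)] by (intro le_supI1 Sup_upper2[of "p y"]) auto
      qed simp
      then have "p x \<le> sup (Sup (p ` Y)) x" unfolding p_def by (auto intro!: Sup_least)
      moreover have "sup (Sup (p ` Y)) x \<le> p x"
        using le_p[OF x] p_mono unfolding Y_def by (auto intro!: Sup_least)
      ultimately have "p x = sup (Sup (p ` Y)) x" by (rule antisym)
      then have "k (p x) \<le> sup (k (Sup (p ` Y))) (k x)"
        using sup[of "Sup (p ` Y)" x] Sup[of "p ` Y"] p_S X x by auto
      \<comment> \<open>The earlier partial joins form a well-ordered chain, so the hypothesis on
        chains applies; the induction hypothesis then bounds each \<open>k (p y)\<close>.\<close>
      moreover have "k (Sup (p ` Y)) \<le> Sup (k ` p ` Y)"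
        using p_S by (intro wo wo_p[OF Y]) auto
      moreover have "Sup (k ` p ` Y) \<le> Sup (k ` X)"
        using less.IH Y unfolding Y_def by (auto intro!: Sup_least)
      moreover have "k x \<le> Sup (k ` X)" using x by (intro Sup_upper) simp
      ultimately show "k (p x) \<le> Sup (k ` X)" by (meson le_supI order_trans)
    qed
  qed
  then have "Sup (k ` p ` X) \<le> Sup (k ` X)" by (auto intro!: Sup_least)
  moreover have "k (Sup (p ` X)) \<le> Sup (k ` p ` X)"
    using p_S by (intro wo wo_p) auto
  moreover have "Sup (p ` X) = Sup X"
  proof (rule antisym)
    show "Sup (p ` X) \<le> Sup X" unfolding p_def by (auto intro!: Sup_least intro: Sup_upper)
    show "Sup X \<le> Sup (p ` X)" using le_p by (auto intro!: Sup_least intro: Sup_upper2)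
  qed
  ultimately show ?thesis by simp
qed

lemma frame_homD:
  assumes "frame_hom h"
  shows "h top = top" "h (inf x y) = inf (h x) (h y)" "h (Sup A) = Sup (h ` A)"
    and "h bot = bot" "h (sup x y) = sup (h x) (h y)" "x \<le> y \<Longrightarrow> h x \<le> h y"
proof -
  show inf: "h (inf x y) = inf (h x) (h y)" for x y using assms by (simp add: frame_hom_def)
  show Sup: "h (Sup A) = Sup (h ` A)" for A using assms by (simp add: frame_hom_def)
  show "h bot = bot" using Sup[of "{}"] by simp
  show "h (sup x y) = sup (h x) (h y)" using Sup[of "{x, y}"] by simp
  show "h x \<le> h y" if "x \<le> y" using inf[of x y] that by (simp add: inf_absorb1 le_iff_inf)
qed (use assms in \<open>simp add: frame_hom_def\<close>)

section \<open>Right adjoints of a dense surjection on the two parts\<close>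

locale dense_extension = szd_biframe L1 L2 for L1 L2 :: "'a::frame set" +
  fixes M1 M2 :: "'m::frame set" and \<V> :: "('m \<times> 'm) set set" and f :: "'m \<Rightarrow> 'a"
  assumes qub: "quasi_uniform_biframe M1 M2 \<V>"
    and qus: "quasi_uniform_surjection M1 M2 \<V> L1 L2 (well_monotone L1 L2) f"
    and dense: "dense_hom f"
begin

lemma subM1: "subframe M1" and subM2: "subframe M2" and generateM: "subframe hull (M1 \<union> M2) = UNIV"
  using qub unfolding quasi_uniform_biframe_def biframe_def by auto

lemma quV: "quasi_uniformity M1 M2 \<V>" and filterV: "paircover_filter M1 M2 \<V>"
  using qub unfolding quasi_uniform_biframe_def quasi_uniformity_def by auto

lemma f_hom: "frame_hom f" and f_image: "f ` M1 = L1" "f ` M2 = L2"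
  using qus
  unfolding quasi_uniform_surjection_def biframe_surjection_def biframe_hom_def by auto

lemmas f_top = frame_homD(1)[OF f_hom] and f_inf = frame_homD(2)[OF f_hom]
  and f_Sup = frame_homD(3)[OF f_hom] and f_bot = frame_homD(4)[OF f_hom]
  and f_mono = frame_homD(6)[OF f_hom]

lemma f_eq_bot_iff: "f x = bot \<longleftrightarrow> x = bot"
  using dense f_bot unfolding dense_hom_def by auto

definition k1 :: "'a \<Rightarrow> 'm" where "k1 x = Sup {m \<in> M1. f m \<le> x}"
definition k2 :: "'a \<Rightarrow> 'm" where "k2 x = Sup {m \<in> M2. f m \<le> x}"

lemma k1_mem: "k1 x \<in> M1" and k2_mem: "k2 x \<in> M2"
  unfolding k1_def k2_def by (auto intro: subframeD(5)[OF subM1] subframeD(5)[OF subM2])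

lemma f_k1_le: "f (k1 x) \<le> x" and f_k2_le: "f (k2 x) \<le> x"
  unfolding k1_def k2_def f_Sup by (auto intro: Sup_least)

lemma le_k1_iff: "m \<in> M1 \<Longrightarrow> m \<le> k1 x \<longleftrightarrow> f m \<le> x"
  and le_k2_iff: "m \<in> M2 \<Longrightarrow> m \<le> k2 x \<longleftrightarrow> f m \<le> x"
  using f_mono[of m "k1 x"] f_k1_le[of x] f_mono[of m "k2 x"] f_k2_le[of x]
  by (auto simp: k1_def k2_def intro: Sup_upper order_trans)

lemma f_k1: "x \<in> L1 \<Longrightarrow> f (k1 x) = x" and f_k2: "x \<in> L2 \<Longrightarrow> f (k2 x) = x"
proof -
  assume "x \<in> L1"
  then obtain m where "m \<in> M1" "f m = x" using f_image(1) by blast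
  then show "f (k1 x) = x" using f_mono[of m "k1 x"] le_k1_iff[of m x] f_k1_le[of x] by auto
next
  assume "x \<in> L2"
  then obtain m where "m \<in> M2" "f m = x" using f_image(2) by blast
  then show "f (k2 x) = x" using f_mono[of m "k2 x"] le_k2_iff[of m x] f_k2_le[of x] by auto
qed

lemma k1_mono: "x \<le> y \<Longrightarrow> k1 x \<le> k1 y"
  by (simp add: le_k1_iff[OF k1_mem]) (rule order_trans[OF f_k1_le])

lemma k2_mono: "x \<le> y \<Longrightarrow> k2 x \<le> k2 y"
  by (simp add: le_k2_iff[OF k2_mem]) (rule order_trans[OF f_k2_le])

lemma k1_inf: "k1 (inf x y) = inf (k1 x) (k1 y)"
proof (rule antisym)
  show "k1 (inf x y) \<le> inf (k1 x) (k1 y)" by (simp add: k1_mono)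
  show "inf (k1 x) (k1 y) \<le> k1 (inf x y)"
    by (simp add: le_k1_iff subframeD(3)[OF subM1] k1_mem f_inf le_infI1 le_infI2 f_k1_le)
qed

lemma k2_inf: "k2 (inf x y) = inf (k2 x) (k2 y)"
proof (rule antisym)
  show "k2 (inf x y) \<le> inf (k2 x) (k2 y)" by (simp add: k2_mono)
  show "inf (k2 x) (k2 y) \<le> k2 (inf x y)"
    by (simp add: le_k2_iff subframeD(3)[OF subM2] k2_mem f_inf le_infI1 le_infI2 f_k2_le)
qed

lemma k1_top: "k1 top = top" and k2_top: "k2 top = top"
  using le_k1_iff[OF subframeD(1)[OF subM1], of top] le_k2_iff[OF subframeD(1)[OF subM2], of top]
  by (simp_all add: top_le)

text \<open>By density it is enough that \<open>f\<close> sends the meet to \<open>bot\<close>, and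
  its image lies below \<open>inf x y\<close>.\<close>

lemma inf_k1_k2_eq_bot: "inf x y = bot \<Longrightarrow> inf (k1 x) (k2 y) = bot"
  using inf_mono[OF f_k1_le[of x] f_k2_le[of y]] by (simp flip: f_eq_bot_iff add: f_inf le_bot)

text \<open>Since images of members of \<open>\<V>\<close> form a base, some \<open>V\<close> has
  its image inside \<open>C_cover_strong L1 L2 A\<close>. By adjunction each pair of
  \<open>V\<close> lies below a lifted pair \<open>(k1 x, k2 y)\<close>, so the lifted pairs
  cover.\<close>

lemma le_k1_k2_coverI:
  assumes A: "finite_union_cover L1 A"
    and le: "\<And>x y. (x, y) \<in> C_cover L1 L2 A \<Longrightarrow> inf x y \<noteq> bot \<Longrightarrow> inf z (inf (k1 x) (k2 y)) \<le> w"
  shows "z \<le> w"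
proof -
  have "C_cover_strong L1 L2 A \<in> well_monotone L1 L2"
    unfolding well_monotone_eq by (rule C_cover_strong_mem[OF A])
  then obtain V where V: "V \<in> \<V>" "down L1 L2 (map_prod f f ` V) \<subseteq> C_cover_strong L1 L2 A"
    using qus unfolding quasi_uniform_surjection_def by blast
  note pc = paircover_filterD(1)[OF filterV V(1)]
  show ?thesis
  proof (rule le_paircoverI[OF pc])
    fix u v assume uv: "(u, v) \<in> V"
    then have mem: "u \<in> M1" "v \<in> M2" using paircover_subset[OF pc] by auto
    then have "(f u, f v) \<in> L1 \<times> L2" using f_image by auto
    then have "(f u, f v) \<in> down L1 L2 (map_prod f f ` V)"
      using uv unfolding down_def by force
    then have "(f u, f v) \<in> C_cover_strong L1 L2 A" using V(2) by blast
    then obtain x y where xy: "(x, y) \<in> C_cover L1 L2 A" "inf x y \<noteq> bot" "f u \<le> x" "f v \<le> y"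
      unfolding C_cover_strong_def down_def by (auto simp: less_eq_prod_def)
    then have "inf z (inf u v) \<le> inf z (inf (k1 x) (k2 y))"
      using mem by (intro inf_mono order_refl) (simp_all add: le_k1_iff le_k2_iff)
    also have "\<dots> \<le> w" using xy by (intro le)
    finally show "inf z (inf u v) \<le> w" .
  qed
qed

section \<open>Preservation of complements and joins by the right adjoints\<close>

lemma inf_k1_k2_compl: "a \<in> L1 \<Longrightarrow> inf (k1 a) (k2 (frame_compl a)) = bot"
  by (intro inf_k1_k2_eq_bot inf_compl)

lemma sup_k1_k2_compl:
  assumes a: "a \<in> L1"
  shows "sup (k1 a) (k2 (frame_compl a)) = top"
proof -
  have "top \<le> sup (k1 a) (k2 (frame_compl a))"
  proof (rule le_k1_k2_coverI[OF finite_union_cover_pair[OF sub1 a]])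
    fix x y assume "(x, y) \<in> C_cover L1 L2 {top, a}"
    then have "x \<le> a \<or> y \<le> frame_compl a"
      using a subframeD(1)[OF sub1] by (subst (asm) C_cover_iff) auto
    then show "inf top (inf (k1 x) (k2 y)) \<le> sup (k1 a) (k2 (frame_compl a))"
      using k1_mono[of x a] k2_mono[of y "frame_compl a"] by (auto intro: le_infI1 le_infI2 le_supI1 le_supI2)
  qed
  then show ?thesis by (simp add: top_le)
qed

text \<open>For a pair \<open>(x, y)\<close> of the cover, either \<open>x\<close> is below some
  \<open>a\<close> in \<open>A\<close>, or \<open>y\<close> is below all their complements. In the
  second case \<open>y\<close> is disjoint from \<open>Sup A\<close>, and
  \<open>inf_k1_k2_eq_bot\<close> transports this to \<open>M\<close>. Passing from \<open>A\<close>
  to a larger \<open>B\<close> leaves room for adjoining \<open>top\<close>.\<close>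

lemma k1_Sup_le_finite_union:
  assumes B: "finite_union_cover L1 B" and A: "A \<subseteq> B"
  shows "k1 (Sup A) \<le> Sup (k1 ` A)"
proof (rule le_k1_k2_coverI[OF B])
  fix x y assume xy: "(x, y) \<in> C_cover L1 L2 B"
  have AL: "A \<subseteq> L1" using A finite_union_cover_subset[OF B] by blast
  show "inf (k1 (Sup A)) (inf (k1 x) (k2 y)) \<le> Sup (k1 ` A)"
  proof (cases "\<exists>a\<in>A. x \<le> a")
    case True
    then obtain a where "a \<in> A" "x \<le> a" by blast
    then have "k1 x \<le> Sup (k1 ` A)" using k1_mono by (intro Sup_upper2[of "k1 a"]) auto
    then show ?thesis by (intro le_infI2 le_infI1)
  next
    case False
    then have "\<forall>a\<in>A. y \<le> frame_compl a"
      using xy A C_cover_iff[OF finite_union_cover_subset[OF B]] by blast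
    then have "y \<le> frame_compl (Sup A)" by (simp add: le_compl_Sup_iff[OF AL])
    then have "inf (Sup A) y = bot"
      by (simp add: le_compl_iff[OF subframeD(5)[OF sub1 AL]] inf_commute)
    from inf_k1_k2_eq_bot[OF this] have "inf (k1 (Sup A)) (inf (k1 x) (k2 y)) = bot"
      by (metis inf_bot_right inf_left_commute)
    then show ?thesis by simp
  qed
qed

text \<open>Arbitrary joins reduce to joins of well-ordered chains and binary joins.\<close>

lemma k1_Sup:
  assumes "A \<subseteq> L1"
  shows "k1 (Sup A) = Sup (k1 ` A)"
proof (rule antisym)
  show "k1 (Sup A) \<le> Sup (k1 ` A)"
  proof (rule Sup_le_Sup_image_well_ordered[OF _ _ _ assms])
    show "k1 (Sup A) \<le> Sup (k1 ` A)" if "A \<subseteq> L1" "well_order_on A (relation_of (\<le>) A)" for A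
      using k1_Sup_le_finite_union[OF finite_union_cover_insert_top[OF sub1 that]] by blast
    \<comment> \<open>\<open>a\<close> and \<open>b\<close> may be incomparable; the union of the
      chains \<open>{top, a}\<close> and \<open>{top, b}\<close> is still an admissible index
      set.\<close>
    show "k1 (sup a b) \<le> sup (k1 a) (k1 b)" if "a \<in> L1" "b \<in> L1" for a b
      using k1_Sup_le_finite_union[OF finite_union_cover_Un[OF finite_union_cover_pair finite_union_cover_pair],
          OF sub1 that(1) sub1 that(2), of "{a, b}"] by simp
    show "Sup A \<in> L1" if "A \<subseteq> L1" for A using sub1 that by (rule subframeD(5))
  qed
  show "Sup (k1 ` A) \<le> k1 (Sup A)" by (auto intro!: Sup_least k1_mono intro: Sup_upper)
qed

section \<open>Generation of the covering frame by values of the right adjoints\<close>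

text \<open>If \<open>v\<close> meets \<open>k1 (f z)\<close>, density makes \<open>f v\<close> meet
  \<open>f (k1 (f z)) = f z\<close>, and then \<open>v\<close> meets \<open>z\<close> itself. So the
  pairs contributing to \<open>k1 (f z)\<close> already occur in the star of
  \<open>z\<close>.\<close>

lemma k1_f_le_st1:
  assumes pc: "paircover M1 M2 U" and z: "z \<in> M1"
  shows "k1 (f z) \<le> st1 z U"
proof (rule le_paircoverI[OF pc])
  fix u v assume uv: "(u, v) \<in> U" "inf (k1 (f z)) (inf u v) \<noteq> bot"
  have "f z \<in> L1" using z f_image(1) by blast
  have "inf (k1 (f z)) v \<noteq> bot" using uv(2) by (metis inf_bot_right inf_left_commute)
  then have "inf (f z) (f v) \<noteq> bot" by (metis f_eq_bot_iff f_inf f_k1[OF \<open>f z \<in> L1\<close>])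
  then have "inf z v \<noteq> bot" by (metis f_bot f_inf)
  with uv(1) show "inf (k1 (f z)) (inf u v) \<le> st1 z U" by (intro le_infI2 le_infI1 le_st1)
qed

lemma k2_f_le_st2:
  assumes pc: "paircover M1 M2 U" and z: "z \<in> M2"
  shows "k2 (f z) \<le> st2 z U"
proof (rule le_paircoverI[OF pc])
  fix u v assume uv: "(u, v) \<in> U" "inf (k2 (f z)) (inf u v) \<noteq> bot"
  have "f z \<in> L2" using z f_image(2) by blast
  have "inf (k2 (f z)) u \<noteq> bot" using uv(2) by (metis inf_bot_left inf_assoc)
  then have "inf (f z) (f u) \<noteq> bot" by (metis f_eq_bot_iff f_inf f_k2[OF \<open>f z \<in> L2\<close>])
  then have "inf z u \<noteq> bot" by (metis f_bot f_inf)
  with uv(1) show "inf (k2 (f z)) (inf u v) \<le> st2 z U" by (intro le_infI2) (rule le_st2)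
qed

text \<open>Admissibility writes \<open>m\<close> as a join of elements \<open>z\<close> with a star
  below \<open>m\<close>; the element \<open>k1 (f z)\<close> lies between \<open>z\<close> and that
  star.\<close>

lemma join_of_k1:
  assumes m: "m \<in> M1"
  shows "m \<le> Sup {z \<in> k1 ` L1. z \<le> m}"
proof -
  have "m = Sup {z \<in> M1. \<exists>U\<in>\<V>. st1 z U \<le> m}"
    using quV m unfolding quasi_uniformity_def by blast
  also have "\<dots> \<le> Sup {z \<in> k1 ` L1. z \<le> m}"
  proof (rule Sup_least, clarify)
    fix z U assume z: "z \<in> M1" "U \<in> \<V>" "st1 z U \<le> m"
    have "k1 (f z) \<le> st1 z U"
      by (rule k1_f_le_st1[OF paircover_filterD(1)[OF filterV z(2)] z(1)])
    then have "k1 (f z) \<le> m" using z(3) by (rule order_trans)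
    moreover have "z \<le> k1 (f z)" using z(1) by (simp add: le_k1_iff)
    ultimately show "z \<le> Sup {z \<in> k1 ` L1. z \<le> m}"
      using z(1) f_image(1) by (intro Sup_upper2[of "k1 (f z)"]) auto
  qed
  finally show ?thesis .
qed

text \<open>With \<open>V\<close> a star refinement of \<open>U\<close>, the maximal pairs \<open>(x, frame_compl c)\<close> of a subcover
  of the image of \<open>V\<close> lift to pairs below members of \<open>U\<close>.\<close>

lemma join_of_k2_compl:
  assumes m: "m \<in> M2"
  shows "m \<le> Sup {z \<in> (\<lambda>a. k2 (frame_compl a)) ` L1. z \<le> m}" (is "_ \<le> ?s")
proof -
  have "m = Sup {z \<in> M2. \<exists>U\<in>\<V>. st2 z U \<le> m}"
    using quV m unfolding quasi_uniformity_def by blast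
  also have "\<dots> \<le> ?s"
  proof (rule Sup_least, clarify)
    fix z U assume z: "z \<in> M2" "U \<in> \<V>" "st2 z U \<le> m"
    obtain V where V: "V \<in> \<V>" "star M1 M2 V \<subseteq> U"
      using quV z(2) unfolding quasi_uniformity_def by blast
    note pc = paircover_filterD(1)[OF filterV V(1)]
    have "down L1 L2 (map_prod f f ` V) \<in> well_monotone L1 L2"
      using qus V(1) unfolding quasi_uniform_surjection_def quasi_uniform_hom_def by blast
    then obtain A where A: "finite_union_cover L1 A"
      and AV: "C_cover_strong L1 L2 A \<subseteq> down L1 L2 (map_prod f f ` V)"
      unfolding well_monotone_eq well_monotone_base_def by blast
    note AL = finite_union_cover_subset[OF A]
    show "z \<le> ?s"
    proof (rule le_k1_k2_coverI[OF A])
      fix x y assume xy: "(x, y) \<in> C_cover L1 L2 A" "inf x y \<noteq> bot"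
      show "inf z (inf (k1 x) (k2 y)) \<le> ?s"
      proof (cases "inf z (k1 x) = bot")
        case True
        then show ?thesis by (simp flip: inf_assoc)
      next
        case False
        \<comment> \<open>\<open>frame_compl c\<close> is the largest second component compatible
          with \<open>x\<close> in the cover. Replacing \<open>y\<close> by it gives a complement,
          as the generators require.\<close>
        define c where "c = Sup {a \<in> A. \<not> x \<le> a}"
        have c: "c \<in> L1" unfolding c_def using AL by (intro subframeD(5)[OF sub1]) blast
        have "y \<le> frame_compl c"
          unfolding c_def using xy(1) C_cover_iff[OF AL] AL by (subst le_compl_Sup_iff) auto
        have "frame_compl c \<le> frame_compl a" if "a \<in> A" "\<not> x \<le> a" for a
          using that AL c by (intro compl_antimono) (auto simp: c_def intro: Sup_upper)
        then have "(x, frame_compl c) \<in> C_cover L1 L2 A"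
          using xy(1) compl_mem[OF c] unfolding C_cover_iff[OF AL] by auto
        moreover have "inf x (frame_compl c) \<noteq> bot"
          using inf_neq_bot_mono[OF xy(2) order_refl \<open>y \<le> frame_compl c\<close>] .
        ultimately have "(x, frame_compl c) \<in> down L1 L2 (map_prod f f ` V)"
          using AV C_cover_strongI by blast
        then obtain u v where uv: "(u, v) \<in> V" "x \<le> f u" "frame_compl c \<le> f v"
          unfolding down_def by (auto simp: less_eq_prod_def)
        have uvM: "u \<in> M1" "v \<in> M2" using uv(1) paircover_subset[OF pc] by auto
        note k1_le = k1_f_le_st1[OF pc uvM(1)] and k2_le = k2_f_le_st2[OF pc uvM(2)]
        have VM: "V \<subseteq> M1 \<times> M2" using pc by (rule paircover_subset)
        have "(st1 u V, st2 v V) \<in> star M1 M2 V"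
          unfolding star_def down_def using uv(1) st1_mem[OF subM1 VM] st2_mem[OF subM2 VM] by blast
        then have "(st1 u V, st2 v V) \<in> U" using V(2) by blast
        \<comment> \<open>\<open>z\<close> meets \<open>k1 x\<close>, which lies below
          \<open>k1 (f u)\<close> and hence below \<open>st1 u V\<close>. So the star pair, a member
          of \<open>U\<close>, contributes its second component to
          \<open>st2 z U \<le> m\<close>.\<close>
        moreover have "inf z (st1 u V) \<noteq> bot"
          using False order_refl order_trans[OF k1_mono[OF uv(2)] k1_le] by (rule inf_neq_bot_mono)
        ultimately have "st2 v V \<le> m" by (rule order_trans[OF le_st2 z(3)])
        then have "k2 (frame_compl c) \<le> m"
          by (rule order_trans[OF order_trans[OF k2_mono[OF uv(3)] k2_le]])
        then have "k2 (frame_compl c) \<le> ?s" using c by (intro Sup_upper) auto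
        moreover have "inf z (inf (k1 x) (k2 y)) \<le> k2 (frame_compl c)"
          using k2_mono[OF \<open>y \<le> frame_compl c\<close>] by (intro le_infI2)
        ultimately show ?thesis by (rule order_trans[rotated])
      qed
    qed
  qed
  finally show ?thesis .
qed

text \<open>The displayed elements are closed under finite meets, because \<open>k1\<close> and
  \<open>k2\<close> preserve meets and complements turn joins into meets. Taking
  \<open>a = bot\<close> or \<open>b = top\<close> yields the generators of \<open>M1\<close> and
  \<open>M2\<close>, so joins of these elements exhaust the frame.\<close>

lemma join_of_inf_k1_k2_compl:
  "m \<le> Sup {g \<in> {inf (k1 b) (k2 (frame_compl a)) | a b. a \<in> L1 \<and> b \<in> L1}. g \<le> m}"
    (is "_ \<le> Sup {g \<in> ?G. g \<le> _}")
proof -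
  have kk: "inf (k1 b) (k2 (frame_compl a)) \<in> ?G" if "a \<in> L1" "b \<in> L1" for a b using that by blast
  note bot = subframeD(2)[OF sub1] and top = subframeD(1)[OF sub1]
  have "subframe {m. m \<le> Sup {g \<in> ?G. g \<le> m}}"
  proof (rule subframe_joins)
    show "top \<in> ?G" using kk[OF bot top] by (simp add: compl_bot k1_top k2_top)
    fix g h assume "g \<in> ?G" "h \<in> ?G"
    then obtain a b a' b' where ab: "a \<in> L1" "b \<in> L1" "a' \<in> L1" "b' \<in> L1"
      "g = inf (k1 b) (k2 (frame_compl a))" "h = inf (k1 b') (k2 (frame_compl a'))" by blast
    then have "inf g h = inf (k1 (inf b b')) (k2 (frame_compl (sup a a')))"
      by (simp add: k1_inf compl_sup k2_inf ac_simps)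
    then show "inf g h \<in> ?G"
      using kk[OF subframeD(4)[OF sub1 ab(1,3)] subframeD(3)[OF sub1 ab(2,4)]] by simp
  qed
  moreover have "m \<le> Sup {g \<in> ?G. g \<le> m}" if m: "m \<in> M1 \<union> M2" for m
  proof -
    have "k1 ` L1 \<subseteq> ?G" using kk[OF bot] by (auto simp: compl_bot k2_top)
    then have "Sup {z \<in> k1 ` L1. z \<le> m} \<le> Sup {g \<in> ?G. g \<le> m}"
      by (intro Sup_subset_mono) blast
    moreover have "(\<lambda>a. k2 (frame_compl a)) ` L1 \<subseteq> ?G" using kk[OF _ top] by (auto simp: k1_top)
    then have "Sup {z \<in> (\<lambda>a. k2 (frame_compl a)) ` L1. z \<le> m} \<le> Sup {g \<in> ?G. g \<le> m}"
      by (intro Sup_subset_mono) blast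
    ultimately show ?thesis using m join_of_k1 join_of_k2_compl by (blast intro: order_trans)
  qed
  ultimately have "subframe hull (M1 \<union> M2) \<subseteq> {m. m \<le> Sup {g \<in> ?G. g \<le> m}}"
    by (intro subframe_hull_least) auto
  then show ?thesis unfolding generateM by blast
qed

section \<open>From injectivity to isomorphism\<close>

text \<open>The range is a subframe containing both parts, which generate the codomain.\<close>

lemma surj_f: "surj f"
proof -
  have "subframe (range f)"
    unfolding subframe_def
  proof (intro conjI ballI allI impI)
    show "top \<in> range f" using f_top by (metis rangeI)
    show "inf x y \<in> range f" if "x \<in> range f" "y \<in> range f" for x y
      using that by (auto simp flip: f_inf)
    show "Sup A \<in> range f" if "A \<subseteq> range f" for A
      using that by (auto simp: subset_image_iff simp flip: f_Sup)
  qed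
  moreover have "L1 \<union> L2 \<subseteq> range f" using f_image by blast
  ultimately have "subframe hull (L1 \<union> L2) \<subseteq> range f" by (intro subframe_hull_least)
  then show ?thesis unfolding generate by blast
qed

text \<open>The inverse inherits the frame operations from \<open>f\<close>. For uniformity, a
  \<open>V\<close> with image inside \<open>W\<close> is contained in the image of \<open>W\<close>
  under the inverse, and the filter is closed upwards.\<close>

lemma quasi_uniform_iso_if_inj:
  assumes inj: "inj f"
  shows "quasi_uniform_iso M1 M2 \<V> L1 L2 (well_monotone L1 L2) f"
proof -
  define g where "g = inv f"
  have gf: "g (f x) = x" for x unfolding g_def using inj by simp
  have fg: "f (g x) = x" for x unfolding g_def using surj_f by (simp add: surj_f_inv_f)
  have "frame_hom g"
    unfolding frame_hom_def
  proof (intro conjI allI)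
    show "g top = top" using gf[of top] by (simp add: f_top)
    show "g (inf x y) = inf (g x) (g y)" for x y using gf[of "inf (g x) (g y)"] by (simp add: f_inf fg)
    show "g (Sup A) = Sup (g ` A)" for A using gf[of "Sup (g ` A)"] by (simp add: f_Sup fg image_image)
  qed
  moreover have g_image: "g ` L1 = M1" "g ` L2 = M2"
    using f_image by (auto simp: image_image gf simp flip: f_image)
  ultimately have g_hom: "biframe_hom L1 L2 M1 M2 g" by (simp add: biframe_hom_def)
  have "down M1 M2 (map_prod g g ` W) \<in> \<V>" if W: "W \<in> well_monotone L1 L2" for W
  proof -
    obtain V where V: "V \<in> \<V>" "down L1 L2 (map_prod f f ` V) \<subseteq> W"
      using qus W unfolding quasi_uniform_surjection_def by blast
    note pc = paircover_filterD(1)[OF filterV V(1)]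
    have "map_prod f f ` V \<subseteq> L1 \<times> L2" using paircover_subset[OF pc] f_image by auto
    then have "map_prod f f ` V \<subseteq> W" using subset_down V(2) by blast
    then have "map_prod g g ` map_prod f f ` V \<subseteq> map_prod g g ` W" by (rule image_mono)
    then have "V \<subseteq> map_prod g g ` W" by (simp add: image_image gf map_prod_def case_prod_beta)
    then have "V \<subseteq> down M1 M2 (map_prod g g ` W)"
      using subset_down[OF paircover_subset[OF pc]] unfolding down_def by blast
    then show ?thesis
      by (intro paircover_filterD(2)[OF filterV V(1)] paircover_mono[OF pc _ downset_down])
  qed
  with g_hom have "quasi_uniform_hom L1 L2 (well_monotone L1 L2) M1 M2 \<V> g"
    by (simp add: quasi_uniform_hom_def)
  then show ?thesis
    using qus gf fg unfolding quasi_uniform_iso_def quasi_uniform_surjection_def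
    by (auto simp: fun_eq_iff)
qed

end


section \<open>Congruence frames\<close>

lemma closed_congruence_mono: "a \<le> b \<Longrightarrow> closed_congruence a \<le> closed_congruence b"
proof -
  assume ab: "a \<le> b"
  have "sup x b = sup y b" if "sup x a = sup y a" for x y
    using that ab by (metis sup.absorb2 sup_assoc)
  then show ?thesis unfolding less_eq_congruence.rep_eq closed_congruence.rep_eq by blast
qed

lemma Sup_closed_congruence: "Sup (closed_congruence ` A) = closed_congruence (Sup A)"
proof (rule antisym)
  show "Sup (closed_congruence ` A) \<le> closed_congruence (Sup A)"
    by (auto intro!: SUP_least closed_congruence_mono intro: Sup_upper)
  have "Pair bot ` A \<subseteq> rel (Sup (closed_congruence ` A))"
  proof clarify
    fix a assume a: "a \<in> A"
    have "(bot, a) \<in> rel (closed_congruence a)" by (simp add: closed_congruence.rep_eq)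
    moreover have "closed_congruence a \<le> Sup (closed_congruence ` A)" using a by (intro Sup_upper) simp
    ultimately show "(bot, a) \<in> rel (Sup (closed_congruence ` A))"
      unfolding less_eq_congruence.rep_eq by blast
  qed
  from rel_Sup[OF this] have *: "(bot, Sup A) \<in> rel (Sup (closed_congruence ` A))"
    by (cases "A = {}") (auto simp: image_image)
  show "closed_congruence (Sup A) \<le> Sup (closed_congruence ` A)"
    unfolding less_eq_congruence.rep_eq closed_congruence.rep_eq
  proof clarify
    fix x y assume xy: "sup x (Sup A) = sup y (Sup A)"
    have "(z, sup z (Sup A)) \<in> rel (Sup (closed_congruence ` A))" for z
      using rel_sup[OF rel_refl[of z] *] by simp
    then show "(x, y) \<in> rel (Sup (closed_congruence ` A))"
      using xy by (metis rel_sym rel_trans)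
  qed
qed

lemma inf_closed_congruence:
  "inf (closed_congruence a) (closed_congruence b) = closed_congruence (inf a b)"
proof (rule antisym)
  show "inf (closed_congruence a) (closed_congruence b) \<le> closed_congruence (inf a b)"
    by transfer (auto simp: sup_inf_distrib1)
  show "closed_congruence (inf a b) \<le> inf (closed_congruence a) (closed_congruence b)"
    by (simp add: closed_congruence_mono)
qed

text \<open>The meet on the left is the congruence generated by the single pair
  \<open>(a, sup a b)\<close>. If \<open>sup x b = sup y b\<close>, then \<open>x\<close> is the
  join of \<open>inf x y\<close> and \<open>inf x (sup a b)\<close>, and modulo
  \<open>\<theta>\<close> the element \<open>sup a b\<close> may be replaced by
  \<open>a\<close>.\<close>

lemma inf_closed_open_le_iff:
  "inf (closed_congruence b) (open_congruence a) \<le> \<theta> \<longleftrightarrow> (a, sup a b) \<in> rel \<theta>"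
proof
  have "(a, sup a b) \<in> rel (inf (closed_congruence b) (open_congruence a))"
    by (simp add: inf_congruence.rep_eq closed_congruence.rep_eq open_congruence.rep_eq inf_commute)
  then show "inf (closed_congruence b) (open_congruence a) \<le> \<theta> \<Longrightarrow> (a, sup a b) \<in> rel \<theta>"
    unfolding less_eq_congruence.rep_eq by blast
next
  assume *: "(a, sup a b) \<in> rel \<theta>"
  have le: "(x, sup (inf x y) (inf x a)) \<in> rel \<theta>" if "sup x b = sup y b" for x y
  proof -
    have "inf x (sup y b) = x" using that by (metis inf_sup_absorb)
    then have "x = sup (inf x y) (inf x (sup a b))"
      by (metis inf_sup_absorb inf_sup_distrib1 le_iff_sup sup_assoc sup_commute sup_inf_absorb)
    moreover have "(sup (inf x y) (inf x (sup a b)), sup (inf x y) (inf x a)) \<in> rel \<theta>"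
      by (intro rel_sup rel_inf rel_refl rel_sym[OF *])
    ultimately show ?thesis by simp
  qed
  show "inf (closed_congruence b) (open_congruence a) \<le> \<theta>"
    unfolding less_eq_congruence.rep_eq inf_congruence.rep_eq closed_congruence.rep_eq
      open_congruence.rep_eq
  proof clarify
    fix x y assume xy: "sup x b = sup y b" "inf x a = inf y a"
    \<comment> \<open>As \<open>inf x a = inf y a\<close>, the reduced form of \<open>x\<close> is
      also that of \<open>y\<close>.\<close>
    have "(x, sup (inf x y) (inf x a)) \<in> rel \<theta>" "(y, sup (inf x y) (inf x a)) \<in> rel \<theta>"
      using le[OF xy(1)] le[OF xy(1)[symmetric]] xy(2) by (simp_all add: inf_commute)
    then show "(x, y) \<in> rel \<theta>" by (blast intro: rel_sym rel_trans)
  qed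
qed

text \<open>This is the kernel of \<open>x \<mapsto> sup (k x) m\<close>. That map preserves binary
  meets and nonempty joins; the empty join is covered by reflexivity in
  \<open>frame_congruenceI\<close>.\<close>

lemma frame_congruence_pullback_closed:
  fixes k :: "'a::frame \<Rightarrow> 'm::frame"
  assumes inf: "\<And>x y. k (inf x y) = inf (k x) (k y)" and Sup: "\<And>A. k (Sup A) = Sup (k ` A)"
  shows "frame_congruence {(x, y). sup (k x) m = sup (k y) m}"
proof (rule frame_congruenceI, goal_cases)
  case (4 x y x' y')
  then show ?case by (simp add: inf sup_inf_distrib2)
next
  case (5 A)
  have "(SUP p\<in>A. sup (k (fst p)) m) = (SUP p\<in>A. sup (k (snd p)) m)"
    using 5(2) by (intro SUP_cong) auto
  then have "sup (SUP p\<in>A. k (fst p)) m = sup (SUP p\<in>A. k (snd p)) m"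
    using 5(1) by (simp flip: SUP_sup_distrib)
  then show ?case by (simp add: Sup image_image)
qed auto

text \<open>\<open>f\<close> reflects the order: each \<open>m\<close> is the join of the elements
  \<open>inf (k b) (l a)\<close> below it, and \<open>f m\<close> determines which these
  are.\<close>

lemma dense_extension_congruence_inj:
  assumes "dense_extension closed_part open_part M1 M2 \<V> (f :: 'm::frame \<Rightarrow> 'a::frame congruence)"
  shows "inj f"
proof -
  interpret dense_extension closed_part open_part M1 M2 \<V> f by (rule assms)
  define k where "k a = k1 (closed_congruence a)" for a
  define l where "l a = k2 (open_congruence a)" for a
  have closed: "closed_congruence a \<in> closed_part" for a :: 'a by (simp add: closed_part_def)
  have opn: "open_congruence a \<in> open_part" for a :: 'a
    using compl_mem[OF closed] by (simp add: frame_compl_closed_congruence)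
  have k_inf: "k (inf x y) = inf (k x) (k y)" for x y
    by (simp add: k_def k1_inf flip: inf_closed_congruence)
  have k_Sup: "k (Sup A) = Sup (k ` A)" for A
    using k1_Sup[of "closed_congruence ` A"] closed
    by (auto simp: k_def image_image Sup_closed_congruence)
  have k_sup: "k (sup x y) = sup (k x) (k y)" for x y using k_Sup[of "{x, y}"] by simp
  have inf_kl: "inf (k a) (l a) = bot" and sup_kl: "sup (k a) (l a) = top" for a
    using inf_k1_k2_compl[OF closed, of a] sup_k1_k2_compl[OF closed, of a]
    by (auto simp: k_def l_def frame_compl_closed_congruence)
  \<comment> \<open>Since \<open>l a\<close> is the complement of \<open>k a\<close>, the left side
    means \<open>k b \<le> sup (k a) m\<close>. The equation on the right says the same in the form
    of membership in a congruence.\<close>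
  have le_iff: "inf (k b) (l a) \<le> m \<longleftrightarrow> sup (k a) m = sup (k (sup a b)) m" for a b m
  proof
    assume le: "inf (k b) (l a) \<le> m"
    have "k b = sup (inf (k b) (k a)) (inf (k b) (l a))" by (simp flip: inf_sup_distrib1 add: sup_kl)
    also have "\<dots> \<le> sup (k a) m" using le by (intro sup_mono) auto
    finally show "sup (k a) m = sup (k (sup a b)) m"
      by (simp add: k_sup) (metis sup.absorb1 sup_commute sup_left_commute)
  next
    assume "sup (k a) m = sup (k (sup a b)) m"
    then have "k b \<le> sup (k a) m" by (simp add: k_sup le_supI1)
    then have "inf (k b) (l a) \<le> inf (sup (k a) m) (l a)" by (rule inf_mono) simp
    also have "\<dots> = inf m (l a)" by (simp add: inf_sup_distrib2 inf_kl)
    finally show "inf (k b) (l a) \<le> m" by simp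
  qed
  have join: "m \<le> Sup {inf (k b) (l a) | a b. inf (k b) (l a) \<le> m}" for m
  proof -
    have "{g \<in> {inf (k1 b) (k2 (frame_compl a)) | a b. a \<in> closed_part \<and> b \<in> closed_part}. g \<le> m}
      \<subseteq> {inf (k b) (l a) | a b. inf (k b) (l a) \<le> m}"
    proof clarify
      fix a b :: "'a congruence"
      assume "inf (k1 b) (k2 (frame_compl a)) \<le> m" "a \<in> closed_part" "b \<in> closed_part"
      moreover from this obtain a' b' where "a = closed_congruence a'" "b = closed_congruence b'"
        unfolding closed_part_def by blast
      ultimately show "\<exists>a' b'. inf (k1 b) (k2 (frame_compl a)) = inf (k b') (l a') \<and> inf (k b') (l a') \<le> m"
        unfolding k_def l_def by (intro exI[of _ a'] exI[of _ b']) (simp add: frame_compl_closed_congruence)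
    qed
    from order_trans[OF join_of_inf_k1_k2_compl Sup_subset_mono[OF this]] show ?thesis .
  qed
  have f_kl: "f (inf (k b) (l a)) = inf (closed_congruence b) (open_congruence a)" for a b
    by (simp add: f_inf k_def l_def f_k1[OF closed] f_k2[OF opn])
  \<comment> \<open>The closed congruence of \<open>m\<close> pulled back along \<open>k\<close>. It
    contains the pair \<open>(a, sup a b)\<close> exactly when
    \<open>inf (k b) (l a) \<le> m\<close>.\<close>
  define \<theta> where "\<theta> m = Congruence {(x, y). sup (k x) m = sup (k y) m}" for m
  have rel_\<theta>: "rel (\<theta> m) = {(x, y). sup (k x) m = sup (k y) m}" for m
    unfolding \<theta>_def using frame_congruence_pullback_closed[of k m] k_inf k_Sup
    by (simp add: Congruence_inverse)
  have le_\<theta>_iff: "inf (closed_congruence b) (open_congruence a) \<le> \<theta> m \<longleftrightarrow> inf (k b) (l a) \<le> m" for a b m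
    by (simp add: inf_closed_open_le_iff rel_\<theta> le_iff)
  \<comment> \<open>\<open>f\<close> preserves the join of generators below \<open>m\<close>, and
    their images lie below \<open>\<theta> m\<close>.\<close>
  have f_le_\<theta>: "f m \<le> \<theta> m" for m
  proof -
    have "f m \<le> f (Sup {inf (k b) (l a) | a b. inf (k b) (l a) \<le> m})" by (rule f_mono[OF join])
    also have "\<dots> \<le> \<theta> m"
      unfolding f_Sup by (auto intro!: Sup_least simp: f_kl le_\<theta>_iff)
    finally show ?thesis .
  qed
  have "m \<le> m'" if "f m \<le> f m'" for m m'
  proof -
    \<comment> \<open>The image of a generator below \<open>m\<close> lies below \<open>f m\<close>,
      hence below \<open>f m'\<close> and \<open>\<theta> m'\<close>; \<open>le_\<theta>_iff\<close>
      brings the generator back below \<open>m'\<close>.\<close>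
    have "inf (k b) (l a) \<le> m'" if "inf (k b) (l a) \<le> m" for a b
    proof -
      have "inf (closed_congruence b) (open_congruence a) \<le> f m"
        using f_mono[OF that] by (simp add: f_kl)
      also have "\<dots> \<le> \<theta> m'" using \<open>f m \<le> f m'\<close> f_le_\<theta> by (rule order_trans)
      finally show ?thesis by (simp add: le_\<theta>_iff)
    qed
    then have "Sup {inf (k b) (l a) | a b. inf (k b) (l a) \<le> m} \<le> m'" by (auto intro: Sup_least)
    with join show ?thesis by (rule order_trans)
  qed
  then show ?thesis by (auto intro!: injI antisym)
qed

theorem theorem3p3:
  shows "bicomplete TYPE('m::frame)
           (closed_part :: 'a::frame congruence set) open_part
           (well_monotone closed_part open_part)"
proof -
  interpret szd_biframe "closed_part :: 'a congruence set" open_part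
    by unfold_locales (rule strictly_zero_dimensional_congruence)
  have "quasi_uniform_biframe (closed_part :: 'a congruence set) open_part (well_monotone closed_part open_part)"
    unfolding quasi_uniform_biframe_def well_monotone_eq
    using szd quasi_uniformity_base by (simp add: strictly_zero_dimensional_def)
  moreover have "quasi_uniform_iso M1 M2 \<V> closed_part open_part (well_monotone closed_part open_part) f"
    if "quasi_uniform_biframe M1 M2 \<V>" "dense_hom f"
      "quasi_uniform_surjection M1 M2 \<V> closed_part open_part (well_monotone closed_part open_part) f"
    for M1 M2 :: "'m set" and \<V> and f :: "'m \<Rightarrow> 'a congruence"
  proof -
    interpret dense_extension closed_part open_part M1 M2 \<V> f by unfold_locales (fact that)+
    show ?thesis
      by (rule quasi_uniform_iso_if_inj, rule dense_extension_congruence_inj) unfold_locales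
  qed
  ultimately show ?thesis unfolding bicomplete_def by blast
qed

end
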